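(* In an augmented virtual double category $\mathcal K$ let $f\colon A\to C$ and $g\colon B\to D$ be vertical morphisms such that the companion $f_*\colon A\nrightarrow C$ and the conjoint $g^*\colon D\nrightarrow B$ exist. Let $\varepsilon_f\colon f_*\Rightarrow(C)$ and $\varepsilon_g\colon g^*\Rightarrow(D)$ be cartesian cells defining them, with corresponding weakly cocartesian cells $\eta_f\colon(A)\Rightarrow f_*$ and $\eta_g\colon(B)\Rightarrow g^*$. For each path $\underline K\colon C\nrightarrow D$ of length $\le1$ the restriction $\underline K(f,g)$ exists if and only if the horizontal composite of the path $f_*\frown\underline K\frown g^*$ does, and in that case they are isomorphic. In detail, let $J\colon A\nrightarrow B$ be a horizontal morphism, let $\phi\colon f_*\frown\underline K\frown g^*\Rightarrow J$ be a horizontal cell and let $\psi\colon J\Rightarrow\underline K$ be a cell with vertical source $f$ and vertical target $g$, such that $$\varepsilon_f\odot\mathrm{id}_{\underline K}\odot\varepsilon_g=\psi\circ\phi$$ (where $\mathrm{id}_{\underline K}$ is the identity cell of $K$ if $\underline K=(K)$, and the vertical identity cell $\mathrm{id}_C$ if $\underline K=(C)$). Then the following are equivalent: (i) $\psi$ is cartesian; (ii) $\phi$ is cocartesian; (iii) $\phi\circ(\eta_f,\psi,\eta_g)=\mathrm{id}_J$. Moreover, in this case the path $(\eta_f,\psi,\eta_g)$ is cocartesian. Analogous assertions hold for one-sided restrictions (with $g=\mathrm{id}_D$ and the cells $\varepsilon_g,\eta_g$ and the morphism $g^*$ omitted, respectively with $f=\mathrm{id}_C$ and $\varepsilon_f,\eta_f,f_*$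 omitted). In particular, for $K\colon C\nrightarrow D$, if $f_*$ exists then $K(f,\mathrm{id})$ exists precisely if the horizontal composite $f_*\odot K$ does, and if $g^*$ exists then $K(\mathrm{id},g)$ exists if and only if $K\odot g^*$ does.
   Context: **Augmented virtual double categories.** An augmented virtual double category $\mathcal K$ consists of: a class of objects; a category $\mathcal K_{\mathrm v}$ with these objects, whose morphisms $f\colon A\to C$ are called vertical; a directed graph $\mathcal K_{\mathrm h}$ with these objects as vertices, whose edges $J\colon A\nrightarrow B$ are called horizontal morphisms; and a class of cells. Each cell $\phi$ has a horizontal source, which is a (possibly empty) path $\underline J=(J_1,\dots,J_n)\colon A_0\nrightarrow A_n$ of horizontal morphisms; a horizontal target, which is a path $\underline K\colon C\nrightarrow D$ of length $|\underline K|\le 1$; a vertical source $f\colon A_0\to C$; and a vertical target $g\colon A_n\to D$. We write $\phi\colon\underline J\Rightarrow\underline K$. The empty path at $A$ is written $(A)$ (so $\underline K=(C)$ forces $C=D$), and $\frown$ denotes concatenation of paths. For each $n\ge 1$, each path of cells $\phi_i\colon\underline J_i\Rightarrow\underline K_i$ ($1\le i\le n$) with vertical source $f_{i-1}$ and vertical target $f_i$, and each cell $\psi\colon\underline K_1\frown\dots\frown\underline K_n\Rightarrow\underline L$ with vertical source $h$ and target $k$, there is a vertical composite $\psi\circ(\phi_1,\dots,\phi_n)\colon\underline J_1\frown\dots\frown\underline J_n\Rightarrow\underline L$ with vertical source $h\circ f_0$ and target $k\circ f_n$. There are horizontal identity cells $\mathrm{id}_J\colon J\Rightarrow J$ (with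 identities as vertical source and target) and vertical identity cells $\mathrm{id}_f\colon (A)\Rightarrow(C)$ for $f\colon A\to C$ (with vertical source and target $f$), with $\mathrm{id}_h\circ(\mathrm{id}_f)=\mathrm{id}_{h\circ f}$; write $\mathrm{id}_A:=\mathrm{id}_{\mathrm{id}_A}$. Axioms, whenever they make sense (for associativity: whenever both sides make sense): $\chi\circ(\psi_1\circ(\phi_{11},\dots,\phi_{1m_1}),\dots,\psi_n\circ(\phi_{n1},\dots,\phi_{nm_n}))=(\chi\circ(\psi_1,\dots,\psi_n))\circ(\phi_{11},\dots,\phi_{nm_n})$; $\mathrm{id}_C\circ(\phi)=\phi$; $\mathrm{id}_K\circ(\phi)=\phi$; $\phi\circ(\mathrm{id}_A)=\phi$; $\phi\circ(\mathrm{id}_{J_1},\dots,\mathrm{id}_{J_n})=\phi$; and $\psi\circ(\phi_1,\dots,\phi_i,\mathrm{id}_{f_i},\phi_{i+1},\dots,\phi_n)=\psi\circ(\phi_1,\dots,\phi_n)$ for $0\le i\le n$. A cell is horizontal if its vertical source and target are identities. Horizontal composition of cells: if $\phi\colon\underline J\Rightarrow\underline K$ and $\psi\colon\underline H\Rightarrow\underline L$ are such that the vertical target of $\phi$ is the vertical source of $\psi$ and $|\underline K|+|\underline L|\le1$, then $\phi\odot\psi:=\mathrm{id}_{\underline K\frown\underline L}\circ(\phi,\psi)\colon\underline J\frown\underline H\Rightarrow\underline K\frown\underline L$, where $\mathrm{id}_{\underline K\frown\underline L}$ is the identity cell of the single horizontal morphism in $\underline K\frown\underline L$, or $\mathrm{id}_C$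 if $\underline K\frown\underline L=(C)$; $\odot$ is associative. **Cartesian cells and restrictions.** A cell $\psi\colon\underline J\Rightarrow\underline K$ with $|\underline J|\le1$, $\underline J\colon A\nrightarrow B$, vertical source $f\colon A\to C$ and target $g\colon B\to D$, is cartesian if every cell $\chi\colon\underline H\Rightarrow\underline K$, with $\underline H\colon X_0\nrightarrow X_n$ and with vertical source $f\circ h$ and target $g\circ k$ (for any $h\colon X_0\to A$, $k\colon X_n\to B$), factors as $\chi=\psi\circ\phi$ for a unique $\phi\colon\underline H\Rightarrow\underline J$ with vertical source $h$ and target $k$. If $|\underline J|=1$ its horizontal source $J$ is called the restriction of $\underline K$ along $f$ and $g$, denoted $\underline K(f,g)$. **Companions and conjoints.** The companion of $f\colon A\to C$ is the restriction $f_*:=C(f,\mathrm{id}_C)\colon A\nrightarrow C$; its defining cartesian cell $\varepsilon_f\colon f_*\Rightarrow(C)$ has vertical source $f$ and target $\mathrm{id}_C$. The corresponding weakly cocartesian cell $\eta_f\colon(A)\Rightarrow f_*$, with vertical source $\mathrm{id}_A$ and target $f$, is the unique cell with $\varepsilon_f\circ\eta_f=\mathrm{id}_f$ (it also satisfies $\eta_f\odot\varepsilon_f=\mathrm{id}_{f_*}$). The conjoint of $g\colon B\to D$ is the restriction $g^*:=D(\mathrm{id}_D,g)\colon D\nrightarrow B$; its defining cartesian cell $\varepsilon_g\colon g^*\Rightarrow(D)$ has vertical source $\mathrm{id}_D$ and target $g$. The corresponding weakly cocartesian cell $\eta_g\colon(B)\Rightarrow g^*$, with vertical source $g$ and target $\mathrm{id}_B$,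 is the unique cell with $\varepsilon_g\circ\eta_g=\mathrm{id}_g$ (it also satisfies $\varepsilon_g\odot\eta_g=\mathrm{id}_{g^*}$). **Cocartesian paths and horizontal composites.** A path of cells $(\phi_1,\dots,\phi_n)$, $n\ge1$, with $\phi_i\colon\underline H_i\Rightarrow\underline J_i$ having vertical source $f_{i-1}$ and target $f_i$, is weakly cocartesian if every cell $\chi\colon\underline H_1\frown\dots\frown\underline H_n\Rightarrow\underline K$ with vertical source $h\circ f_0$ and target $k\circ f_n$ factors as $\chi=\chi'\circ(\phi_1,\dots,\phi_n)$ for a unique $\chi'\colon\underline J_1\frown\dots\frown\underline J_n\Rightarrow\underline K$ with vertical source $h$ and target $k$. Let $A_0$ and $A_n$ be the codomains of $f_0$ and $f_n$. The path is cocartesian if every path $(\mathrm{id}_{H'_1},\dots,\mathrm{id}_{H'_{p-1}},\mathrm{cart},\phi_1,\dots,\phi_n,\mathrm{cart},\mathrm{id}_{H''_2},\dots,\mathrm{id}_{H''_q})$ is weakly cocartesian, where $p,q\ge0$, $(H'_1,\dots,H'_p)$ is any path ending at $A_0$ for which the restriction $H'_p(\mathrm{id},f_0)$ exists, $(H''_1,\dots,H''_q)$ is any path starting at $A_n$ for which $H''_1(f_n,\mathrm{id})$ exists, and the cells $\mathrm{cart}$ are cartesian cells defining these restrictions (if $p=0$ the path starts with $\phi_1$, if $q=0$ it ends with $\phi_n$). A single cell is (weakly) cocartesian if it is so as a path of length 1. A horizontal cocartesian cell $(H_1,\dots,H_n)\Rightarrow J$, $n\ge1$, defines $J$ as the horizontal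 composite $(H_1\odot\dots\odot H_n)$. *)

theory Defs
  imports Main
begin

section \<open>Augmented virtual double categories\<close>

text \<open>
  All operations are total; they are only constrained (in the locale below) on the carriers
  and on composable arguments. A path of horizontal morphisms is the list of its edges. The
  empty path at an object is the list \<^term>\<open>[]\<close>: its object is not stored, since wherever a path
  occurs it is recorded separately (for the horizontal source and target of a cell it is the
  domain, respectively codomain, of the vertical source and target).
\<close>

record ('o, 'v, 'h, 'c) avdc =
  Obj :: "'o set"
  Ver :: "'v set"
  Dom :: "'v \<Rightarrow> 'o"
  Cod :: "'v \<Rightarrow> 'o"
  Idt :: "'o \<Rightarrow> 'v"
  vcomp :: "'v \<Rightarrow> 'v \<Rightarrow> 'v" (infixr "\<cdot>\<index>" 75)
  Hor :: "'h set"
  Src :: "'h \<Rightarrow> 'o"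
  Tgt :: "'h \<Rightarrow> 'o"
  Cells :: "'c set"
  HSrc :: "'c \<Rightarrow> 'h list"
  HTgt :: "'c \<Rightarrow> 'h list"
  VSrc :: "'c \<Rightarrow> 'v"
  VTgt :: "'c \<Rightarrow> 'v"
  idH :: "'h \<Rightarrow> 'c"
  idV :: "'v \<Rightarrow> 'c"
  ccomp :: "'c \<Rightarrow> 'c list \<Rightarrow> 'c" (infixr "\<star>\<index>" 75)

definition vmor :: "('o, 'v, 'h, 'c) avdc \<Rightarrow> 'v \<Rightarrow> 'o \<Rightarrow> 'o \<Rightarrow> bool" where
  "vmor \<K> f A C \<longleftrightarrow> f \<in> Ver \<K> \<and> Dom \<K> f = A \<and> Cod \<K> f = C"

definition hmor :: "('o, 'v, 'h, 'c) avdc \<Rightarrow> 'h \<Rightarrow> 'o \<Rightarrow> 'o \<Rightarrow> bool" where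
  "hmor \<K> J A B \<longleftrightarrow> J \<in> Hor \<K> \<and> Src \<K> J = A \<and> Tgt \<K> J = B"

fun hpath :: "('o, 'v, 'h, 'c) avdc \<Rightarrow> 'o \<Rightarrow> 'h list \<Rightarrow> 'o \<Rightarrow> bool" where
  "hpath \<K> A [] B \<longleftrightarrow> A \<in> Obj \<K> \<and> A = B"
| "hpath \<K> A (J # Js) B \<longleftrightarrow> J \<in> Hor \<K> \<and> Src \<K> J = A \<and> hpath \<K> (Tgt \<K> J) Js B"

definition cell_in ::
  "('o, 'v, 'h, 'c) avdc \<Rightarrow> 'c \<Rightarrow> 'h list \<Rightarrow> 'h list \<Rightarrow> 'v \<Rightarrow> 'v \<Rightarrow> bool" where
  "cell_in \<K> \<phi> Js Ks f g \<longleftrightarrow>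
     \<phi> \<in> Cells \<K> \<and> HSrc \<K> \<phi> = Js \<and> HTgt \<K> \<phi> = Ks \<and> VSrc \<K> \<phi> = f \<and> VTgt \<K> \<phi> = g"

definition cell_path :: "('o, 'v, 'h, 'c) avdc \<Rightarrow> 'c list \<Rightarrow> bool" where
  "cell_path \<K> \<phi>s \<longleftrightarrow>
     \<phi>s \<noteq> [] \<and> set \<phi>s \<subseteq> Cells \<K> \<and> successively (\<lambda>\<phi> \<psi>. VTgt \<K> \<phi> = VSrc \<K> \<psi>) \<phi>s"

text \<open>The conditions on \<^const>\<open>Dom\<close> and \<^const>\<open>Cod\<close> compare the endpoints of the two paths,
  which the lists of edges do not determine when they are empty.\<close>

definition composable :: "('o, 'v, 'h, 'c) avdc \<Rightarrow> 'c \<Rightarrow> 'c list \<Rightarrow> bool" where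
  "composable \<K> \<psi> \<phi>s \<longleftrightarrow>
     \<psi> \<in> Cells \<K> \<and> cell_path \<K> \<phi>s \<and>
     HSrc \<K> \<psi> = concat (map (HTgt \<K>) \<phi>s) \<and>
     Dom \<K> (VSrc \<K> \<psi>) = Cod \<K> (VSrc \<K> (hd \<phi>s)) \<and>
     Dom \<K> (VTgt \<K> \<psi>) = Cod \<K> (VTgt \<K> (last \<phi>s))"

locale augmented_virtual_double_category =
  fixes \<K> :: "('o, 'v, 'h, 'c) avdc" (structure)
  assumes Dom_in: "f \<in> Ver \<K> \<Longrightarrow> Dom \<K> f \<in> Obj \<K>"
    and Cod_in: "f \<in> Ver \<K> \<Longrightarrow> Cod \<K> f \<in> Obj \<K>"
    and Idt_vmor: "A \<in> Obj \<K> \<Longrightarrow> vmor \<K> (Idt \<K> A) A A"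
    and vcomp_vmor: "vmor \<K> f A B \<Longrightarrow> vmor \<K> g B C \<Longrightarrow> vmor \<K> (g \<cdot> f) A C"
    and vcomp_Idt: "vmor \<K> f A B \<Longrightarrow> f \<cdot> Idt \<K> A = f"
    and Idt_vcomp: "vmor \<K> f A B \<Longrightarrow> Idt \<K> B \<cdot> f = f"
    and vcomp_assoc: "vmor \<K> f A B \<Longrightarrow> vmor \<K> g B C \<Longrightarrow> vmor \<K> h C D \<Longrightarrow>
      h \<cdot> (g \<cdot> f) = (h \<cdot> g) \<cdot> f"
    and Src_in: "J \<in> Hor \<K> \<Longrightarrow> Src \<K> J \<in> Obj \<K>"
    and Tgt_in: "J \<in> Hor \<K> \<Longrightarrow> Tgt \<K> J \<in> Obj \<K>"
    and VSrc_in: "\<phi> \<in> Cells \<K> \<Longrightarrow> VSrc \<K> \<phi> \<in> Ver \<K>"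
    and VTgt_in: "\<phi> \<in> Cells \<K> \<Longrightarrow> VTgt \<K> \<phi> \<in> Ver \<K>"
    and HSrc_path: "\<phi> \<in> Cells \<K> \<Longrightarrow>
      hpath \<K> (Dom \<K> (VSrc \<K> \<phi>)) (HSrc \<K> \<phi>) (Dom \<K> (VTgt \<K> \<phi>))"
    and HTgt_path: "\<phi> \<in> Cells \<K> \<Longrightarrow>
      hpath \<K> (Cod \<K> (VSrc \<K> \<phi>)) (HTgt \<K> \<phi>) (Cod \<K> (VTgt \<K> \<phi>))"
    and HTgt_length: "\<phi> \<in> Cells \<K> \<Longrightarrow> length (HTgt \<K> \<phi>) \<le> 1"
    and ccomp_cell: "composable \<K> \<psi> \<phi>s \<Longrightarrow>
      cell_in \<K> (\<psi> \<star> \<phi>s) (concat (map (HSrc \<K>) \<phi>s)) (HTgt \<K> \<psi>)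
        (VSrc \<K> \<psi> \<cdot> VSrc \<K> (hd \<phi>s)) (VTgt \<K> \<psi> \<cdot> VTgt \<K> (last \<phi>s))"
    and idH_cell: "hmor \<K> J A B \<Longrightarrow> cell_in \<K> (idH \<K> J) [J] [J] (Idt \<K> A) (Idt \<K> B)"
    and idV_cell: "f \<in> Ver \<K> \<Longrightarrow> cell_in \<K> (idV \<K> f) [] [] f f"
    and idV_vcomp: "vmor \<K> f A B \<Longrightarrow> vmor \<K> h B C \<Longrightarrow>
      idV \<K> h \<star> [idV \<K> f] = idV \<K> (h \<cdot> f)"
    and ccomp_assoc: "list_all2 (composable \<K>) \<psi>s \<phi>ss \<Longrightarrow>
      composable \<K> \<chi> (map2 (\<lambda>\<psi> \<phi>s. \<psi> \<star> \<phi>s) \<psi>s \<phi>ss) \<Longrightarrow>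
      composable \<K> \<chi> \<psi>s \<Longrightarrow> composable \<K> (\<chi> \<star> \<psi>s) (concat \<phi>ss) \<Longrightarrow>
      \<chi> \<star> (map2 (\<lambda>\<psi> \<phi>s. \<psi> \<star> \<phi>s) \<psi>s \<phi>ss) = (\<chi> \<star> \<psi>s) \<star> concat \<phi>ss"
    and idV_ccomp: "cell_in \<K> \<phi> Js [] f g \<Longrightarrow> idV \<K> (Idt \<K> (Cod \<K> f)) \<star> [\<phi>] = \<phi>"
    and idH_ccomp: "cell_in \<K> \<phi> Js [K] f g \<Longrightarrow> idH \<K> K \<star> [\<phi>] = \<phi>"
    and ccomp_idV: "cell_in \<K> \<phi> [] Ks f g \<Longrightarrow> \<phi> \<star> [idV \<K> (Idt \<K> (Dom \<K> f))] = \<phi>"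
    and ccomp_idH: "cell_in \<K> \<phi> Js Ks f g \<Longrightarrow> Js \<noteq> [] \<Longrightarrow> \<phi> \<star> map (idH \<K>) Js = \<phi>"
    and ccomp_insert_idV: "f \<in> Ver \<K> \<Longrightarrow> composable \<K> \<psi> (\<phi>s @ \<phi>s') \<Longrightarrow>
      composable \<K> \<psi> (\<phi>s @ idV \<K> f # \<phi>s') \<Longrightarrow>
      \<psi> \<star> (\<phi>s @ idV \<K> f # \<phi>s') = \<psi> \<star> (\<phi>s @ \<phi>s')"

text \<open>The identity cell of a path \<open>Ks\<close> of length at most one starting at \<open>C\<close>.\<close>

definition id_path :: "('o, 'v, 'h, 'c) avdc \<Rightarrow> 'o \<Rightarrow> 'h list \<Rightarrow> 'c" where
  "id_path \<K> C Ks = (if Ks = [] then idV \<K> (Idt \<K> C) else idH \<K> (hd Ks))"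

definition hcomp :: "('o, 'v, 'h, 'c) avdc \<Rightarrow> 'c \<Rightarrow> 'c \<Rightarrow> 'c" (infixl "\<odot>\<index>" 70) where
  "\<phi> \<odot>\<^bsub>\<K>\<^esub> \<psi> =
     id_path \<K> (Cod \<K> (VSrc \<K> \<phi>)) (HTgt \<K> \<phi> @ HTgt \<K> \<psi>) \<star>\<^bsub>\<K>\<^esub> [\<phi>, \<psi>]"

definition hiso :: "('o, 'v, 'h, 'c) avdc \<Rightarrow> 'h \<Rightarrow> 'h \<Rightarrow> bool" where
  "hiso \<K> J J' \<longleftrightarrow> (\<exists>A B \<alpha> \<beta>.
     hmor \<K> J A B \<and> hmor \<K> J' A B \<and>
     cell_in \<K> \<alpha> [J] [J'] (Idt \<K> A) (Idt \<K> B) \<and>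
     cell_in \<K> \<beta> [J'] [J] (Idt \<K> A) (Idt \<K> B) \<and>
     \<beta> \<star>\<^bsub>\<K>\<^esub> [\<alpha>] = idH \<K> J \<and> \<alpha> \<star>\<^bsub>\<K>\<^esub> [\<beta>] = idH \<K> J')"

section \<open>Cartesian cells, restrictions, companions and conjoints\<close>

definition cartesian :: "('o, 'v, 'h, 'c) avdc \<Rightarrow> 'c \<Rightarrow> bool" where
  "cartesian \<K> \<psi> \<longleftrightarrow>
     \<psi> \<in> Cells \<K> \<and> length (HSrc \<K> \<psi>) \<le> 1 \<and>
     (\<forall>\<chi> Hs X Y h k.
        vmor \<K> h X (Dom \<K> (VSrc \<K> \<psi>)) \<and> vmor \<K> k Y (Dom \<K> (VTgt \<K> \<psi>)) \<and>
        cell_in \<K> \<chi> Hs (HTgt \<K> \<psi>) (VSrc \<K> \<psi> \<cdot>\<^bsub>\<K>\<^esub> h) (VTgt \<K> \<psi> \<cdot>\<^bsub>\<K>\<^esub> k) \<longrightarrow>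
        (\<exists>!\<phi>. cell_in \<K> \<phi> Hs (HSrc \<K> \<psi>) h k \<and> \<chi> = \<psi> \<star>\<^bsub>\<K>\<^esub> [\<phi>]))"

definition restriction :: "('o, 'v, 'h, 'c) avdc \<Rightarrow> 'h \<Rightarrow> 'h list \<Rightarrow> 'v \<Rightarrow> 'v \<Rightarrow> bool" where
  "restriction \<K> J Ks f g \<longleftrightarrow> (\<exists>\<psi>. cell_in \<K> \<psi> [J] Ks f g \<and> cartesian \<K> \<psi>)"

text \<open>Here \<open>\<epsilon>\<close> is a cell defining \<open>J\<close> as the companion (conjoint) of \<open>f\<close>, and \<open>\<eta>\<close> is
  the cell corresponding to it.\<close>

definition companion ::
  "('o, 'v, 'h, 'c) avdc \<Rightarrow> 'v \<Rightarrow> 'o \<Rightarrow> 'o \<Rightarrow> 'h \<Rightarrow> 'c \<Rightarrow> 'c \<Rightarrow> bool" where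
  "companion \<K> f A C J \<epsilon> \<eta> \<longleftrightarrow>
     vmor \<K> f A C \<and> cell_in \<K> \<epsilon> [J] [] f (Idt \<K> C) \<and> cartesian \<K> \<epsilon> \<and>
     cell_in \<K> \<eta> [] [J] (Idt \<K> A) f \<and> \<epsilon> \<star>\<^bsub>\<K>\<^esub> [\<eta>] = idV \<K> f"

definition conjoint ::
  "('o, 'v, 'h, 'c) avdc \<Rightarrow> 'v \<Rightarrow> 'o \<Rightarrow> 'o \<Rightarrow> 'h \<Rightarrow> 'c \<Rightarrow> 'c \<Rightarrow> bool" where
  "conjoint \<K> f A C J \<epsilon> \<eta> \<longleftrightarrow>
     vmor \<K> f A C \<and> cell_in \<K> \<epsilon> [J] [] (Idt \<K> C) f \<and> cartesian \<K> \<epsilon> \<and>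
     cell_in \<K> \<eta> [] [J] f (Idt \<K> A) \<and> \<epsilon> \<star>\<^bsub>\<K>\<^esub> [\<eta>] = idV \<K> f"

section \<open>Cocartesian paths and horizontal composites\<close>

definition weakly_cocartesian :: "('o, 'v, 'h, 'c) avdc \<Rightarrow> 'c list \<Rightarrow> bool" where
  "weakly_cocartesian \<K> \<phi>s \<longleftrightarrow>
     cell_path \<K> \<phi>s \<and>
     (\<forall>\<chi> Ks X Y h k.
        vmor \<K> h (Cod \<K> (VSrc \<K> (hd \<phi>s))) X \<and> vmor \<K> k (Cod \<K> (VTgt \<K> (last \<phi>s))) Y \<and>
        cell_in \<K> \<chi> (concat (map (HSrc \<K>) \<phi>s)) Ks
          (h \<cdot>\<^bsub>\<K>\<^esub> VSrc \<K> (hd \<phi>s)) (k \<cdot>\<^bsub>\<K>\<^esub> VTgt \<K> (last \<phi>s)) \<longrightarrow>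
        (\<exists>!\<chi>'. cell_in \<K> \<chi>' (concat (map (HTgt \<K>) \<phi>s)) Ks h k \<and> \<chi> = \<chi>' \<star>\<^bsub>\<K>\<^esub> \<phi>s))"

text \<open>The paths of cells that may be put in front of (behind) a path with vertical source
  (target) \<open>f\<close> in the definition of cocartesianness; the empty ones are the cases \<open>p = 0\<close> and
  \<open>q = 0\<close>, while otherwise \<open>H\<close> is the edge \<open>H'\<^sub>p\<close> (\<open>H''\<^sub>1\<close>) next to the path and \<open>c\<close>
  is a cartesian cell defining its restriction along \<open>f\<close>.\<close>

definition left_extension :: "('o, 'v, 'h, 'c) avdc \<Rightarrow> 'v \<Rightarrow> 'c list \<Rightarrow> bool" where
  "left_extension \<K> f cs \<longleftrightarrow> cs = [] \<or>
     (\<exists>X Hs H R c. hpath \<K> X (Hs @ [H]) (Cod \<K> f) \<and>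
        cell_in \<K> c [R] [H] (Idt \<K> (Src \<K> H)) f \<and> cartesian \<K> c \<and>
        cs = map (idH \<K>) Hs @ [c])"

definition right_extension :: "('o, 'v, 'h, 'c) avdc \<Rightarrow> 'v \<Rightarrow> 'c list \<Rightarrow> bool" where
  "right_extension \<K> f cs \<longleftrightarrow> cs = [] \<or>
     (\<exists>Y Hs H R c. hpath \<K> (Cod \<K> f) (H # Hs) Y \<and>
        cell_in \<K> c [R] [H] f (Idt \<K> (Tgt \<K> H)) \<and> cartesian \<K> c \<and>
        cs = c # map (idH \<K>) Hs)"

definition cocartesian :: "('o, 'v, 'h, 'c) avdc \<Rightarrow> 'c list \<Rightarrow> bool" where
  "cocartesian \<K> \<phi>s \<longleftrightarrow>
     cell_path \<K> \<phi>s \<and>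
     (\<forall>ls rs. left_extension \<K> (VSrc \<K> (hd \<phi>s)) ls \<and>
        right_extension \<K> (VTgt \<K> (last \<phi>s)) rs \<longrightarrow>
        weakly_cocartesian \<K> (ls @ \<phi>s @ rs))"

definition horizontal_composite :: "('o, 'v, 'h, 'c) avdc \<Rightarrow> 'h \<Rightarrow> 'h list \<Rightarrow> bool" where
  "horizontal_composite \<K> J Hs \<longleftrightarrow> Hs \<noteq> [] \<and>
     (\<exists>A B \<phi>. hmor \<K> J A B \<and> cell_in \<K> \<phi> Hs [J] (Idt \<K> A) (Idt \<K> B) \<and> cocartesian \<K> [\<phi>])"

end

theory Submission
  imports Defs
begin

text \<open>
  Whenever \<open>\<epsilon>\<^sub>f \<odot> id\<^sub>K \<odot> \<epsilon>\<^sub>g = \<psi> \<circ> \<phi>\<close>, the companion and conjoint identities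
  \<open>\<epsilon>\<^sub>f \<circ> \<eta>\<^sub>f = id\<^sub>f\<close>, \<open>\<eta>\<^sub>f \<odot> \<epsilon>\<^sub>f = id\<close> and their duals say that precomposing with \<open>(\<eta>\<^sub>f, \<psi>, \<eta>\<^sub>g)\<close>
  and then with \<open>\<phi>\<close> is the identity. The condition \<open>\<phi> \<circ> (\<eta>\<^sub>f, \<psi>, \<eta>\<^sub>g) = id\<^sub>J\<close> provides the other
  composite, so that the two paths are mutually inverse and both are weakly cocartesian. As
  their outer vertical morphisms are identities, the cartesian cells that occur in the
  definition of cocartesianness are invertible here, and the same argument applies in the
  extended context. Conversely, the factorisation of \<open>\<chi>\<close> through \<open>\<psi>\<close> is
  \<open>\<phi> \<circ> (\<eta>\<^sub>f \<circ> id\<^sub>h, \<chi>, \<eta>\<^sub>g \<circ> id\<^sub>k)\<close>. The one-sided versions are the two-sided argument in which the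
  missing companion or conjoint is the empty path, with vertical identity cells as structure
  cells.
\<close>

section \<open>Composites of paths of cells\<close>

fun cpath :: "('o, 'v, 'h, 'c) avdc \<Rightarrow> 'v \<Rightarrow> 'c list \<Rightarrow> 'v \<Rightarrow> bool" where
  "cpath \<K> f [] g \<longleftrightarrow> f = g"
| "cpath \<K> f (\<phi> # \<phi>s) g \<longleftrightarrow> \<phi> \<in> Cells \<K> \<and> VSrc \<K> \<phi> = f \<and> cpath \<K> (VTgt \<K> \<phi>) \<phi>s g"

lemma cpath_append:
  "cpath \<K> f (xs @ ys) g \<longleftrightarrow> (\<exists>m. cpath \<K> f xs m \<and> cpath \<K> m ys g)"
  by (induction xs arbitrary: f) auto

lemma cpath_Cells: "cpath \<K> f xs g \<Longrightarrow> set xs \<subseteq> Cells \<K>"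
  by (induction xs arbitrary: f) auto

lemma cpath_ends:
  "cpath \<K> f xs g \<Longrightarrow> xs \<noteq> [] \<Longrightarrow> VSrc \<K> (hd xs) = f \<and> VTgt \<K> (last xs) = g"
  by (induction xs arbitrary: f) (auto split: if_splits)

lemma cell_path_iff:
  "cell_path \<K> xs \<longleftrightarrow> xs \<noteq> [] \<and> cpath \<K> (VSrc \<K> (hd xs)) xs (VTgt \<K> (last xs))"
proof (induction xs)
  case Nil then show ?case by (simp add: cell_path_def)
next
  case (Cons x xs)
  then show ?case
    by (cases xs) (auto simp: cell_path_def)
qed

lemma cell_pathI: "cpath \<K> f xs g \<Longrightarrow> xs \<noteq> [] \<Longrightarrow> cell_path \<K> xs"
  using cpath_ends cell_path_iff by metis

lemma composableI:
  assumes "\<chi> \<in> Cells \<K>" "xs \<noteq> []" "cpath \<K> f xs g" "HSrc \<K> \<chi> = concat (map (HTgt \<K>) xs)"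
    "Dom \<K> (VSrc \<K> \<chi>) = Cod \<K> f" "Dom \<K> (VTgt \<K> \<chi>) = Cod \<K> g"
  shows "composable \<K> \<chi> xs"
  using assms cpath_ends[OF assms(3,2)] cell_pathI[OF assms(3,2)]
  by (auto simp: composable_def)

lemma composableE:
  assumes "composable \<K> \<chi> xs"
  obtains f g where "\<chi> \<in> Cells \<K>" "xs \<noteq> []" "cpath \<K> f xs g"
    "HSrc \<K> \<chi> = concat (map (HTgt \<K>) xs)"
    "Dom \<K> (VSrc \<K> \<chi>) = Cod \<K> f" "Dom \<K> (VTgt \<K> \<chi>) = Cod \<K> g"
  using assms by (auto simp: composable_def cell_path_iff)

lemma hpath_append:
  "hpath \<K> A (xs @ ys) B \<longleftrightarrow> (\<exists>M. hpath \<K> A xs M \<and> hpath \<K> M ys B)"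
  if "A \<in> Obj \<K>" "\<And>J. J \<in> Hor \<K> \<Longrightarrow> Tgt \<K> J \<in> Obj \<K>"
  using that by (induction xs arbitrary: A) auto

lemma hpath_unique:
  assumes "hpath \<K> A xs B" "hpath \<K> A' xs B'" "xs \<noteq> []"
  shows "A = A' \<and> B = B'"
proof -
  have "hpath \<K> M ys B \<Longrightarrow> hpath \<K> M ys B' \<Longrightarrow> B = B'" for M ys
    by (induction ys arbitrary: M) auto
  with assms show ?thesis by (cases xs) auto
qed

text \<open>The cells that act as units even on their own. Vertical identity cells of other
  morphisms f are left out: they may stand next to further cells, but
  \<open>\<chi> \<star> [idV \<K> f]\<close> has f composed into its vertical ends.\<close>

definition identity_cell :: "('o, 'v, 'h, 'c) avdc \<Rightarrow> 'c \<Rightarrow> bool" where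
  "identity_cell \<K> c \<longleftrightarrow>
     (\<exists>X \<in> Obj \<K>. c = idV \<K> (Idt \<K> X)) \<or> (\<exists>J \<in> Hor \<K>. c = idH \<K> J)"

context augmented_virtual_double_category
begin

section \<open>Typing rules for identities and composites, and the behaviour of vertical identity
  cells in paths\<close>

lemma Idt_simps [simp]:
  assumes "A \<in> Obj \<K>"
  shows "Idt \<K> A \<in> Ver \<K>" "Dom \<K> (Idt \<K> A) = A" "Cod \<K> (Idt \<K> A) = A"
  using Idt_vmor[OF assms] by (auto simp: vmor_def)

lemma vcomp_simps [simp]:
  assumes "f \<in> Ver \<K>" "g \<in> Ver \<K>" "Dom \<K> g = Cod \<K> f"
  shows "g \<cdot> f \<in> Ver \<K>" "Dom \<K> (g \<cdot> f) = Dom \<K> f" "Cod \<K> (g \<cdot> f) = Cod \<K> g"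
  using vcomp_vmor[of f "Dom \<K> f" "Cod \<K> f" g "Cod \<K> g"] assms by (auto simp: vmor_def)

lemma vcomp_Idt_simps [simp]:
  assumes "f \<in> Ver \<K>"
  shows "Dom \<K> f = A \<Longrightarrow> f \<cdot> Idt \<K> A = f" "Cod \<K> f = A \<Longrightarrow> Idt \<K> A \<cdot> f = f"
  using vcomp_Idt[of f "Dom \<K> f" "Cod \<K> f"] Idt_vcomp[of f "Dom \<K> f" "Cod \<K> f"] assms
  by (auto simp: vmor_def)

lemma Cells_simps [simp]:
  assumes "\<phi> \<in> Cells \<K>"
  shows "VSrc \<K> \<phi> \<in> Ver \<K>" "VTgt \<K> \<phi> \<in> Ver \<K>"
  using assms VSrc_in VTgt_in by auto

lemma idV_simps [simp]:
  assumes "f \<in> Ver \<K>"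
  shows "idV \<K> f \<in> Cells \<K>" "HSrc \<K> (idV \<K> f) = []" "HTgt \<K> (idV \<K> f) = []"
    "VSrc \<K> (idV \<K> f) = f" "VTgt \<K> (idV \<K> f) = f"
  using idV_cell[OF assms] by (auto simp: cell_in_def)

lemma idH_simps [simp]:
  assumes "J \<in> Hor \<K>"
  shows "idH \<K> J \<in> Cells \<K>" "HSrc \<K> (idH \<K> J) = [J]" "HTgt \<K> (idH \<K> J) = [J]"
    "VSrc \<K> (idH \<K> J) = Idt \<K> (Src \<K> J)" "VTgt \<K> (idH \<K> J) = Idt \<K> (Tgt \<K> J)"
  using idH_cell[of J "Src \<K> J" "Tgt \<K> J"] assms by (auto simp: cell_in_def hmor_def)

lemmas hpath_append' = hpath_append[OF _ Tgt_in]

lemma hpath_Obj: "hpath \<K> A Js B \<Longrightarrow> A \<in> Obj \<K> \<and> B \<in> Obj \<K>"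
  by (induction Js arbitrary: A) (auto simp: Src_in)

lemma ccomp_cell_in:
  assumes "composable \<K> \<chi> xs" "cpath \<K> f xs g"
  shows "cell_in \<K> (\<chi> \<star> xs) (concat (map (HSrc \<K>) xs)) (HTgt \<K> \<chi>)
    (VSrc \<K> \<chi> \<cdot> f) (VTgt \<K> \<chi> \<cdot> g)"
  using ccomp_cell[OF assms(1)] cpath_ends[OF assms(2)] assms(1)
  by (auto simp: composable_def cell_path_def)

text \<open>The insertion axiom asks for composability both with and without
  \<open>idV \<K> f\<close>. A vertical identity cell has empty horizontal source and target and
  equal vertical ends, so each follows from the other (see \<open>composable_delete_idV\<close>),
  provided that f matches its neighbours and, for deletion, that some cell remains.\<close>

lemma composable_insert_idV:
  assumes "composable \<K> \<psi> (xs @ ys)" "f \<in> Ver \<K>"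
    "xs \<noteq> [] \<Longrightarrow> VTgt \<K> (last xs) = f" "ys \<noteq> [] \<Longrightarrow> VSrc \<K> (hd ys) = f"
  shows "composable \<K> \<psi> (xs @ idV \<K> f # ys)"
proof -
  from assms(1) obtain a b where *: "\<psi> \<in> Cells \<K>" "xs @ ys \<noteq> []" "cpath \<K> a (xs @ ys) b"
    "HSrc \<K> \<psi> = concat (map (HTgt \<K>) (xs @ ys))"
    "Dom \<K> (VSrc \<K> \<psi>) = Cod \<K> a" "Dom \<K> (VTgt \<K> \<psi>) = Cod \<K> b"
    by (rule composableE)
  obtain m where m: "cpath \<K> a xs m" "cpath \<K> m ys b"
    using *(3) by (auto simp: cpath_append)
  have "m = f"
    using *(2) cpath_ends[OF m(1)] cpath_ends[OF m(2)] assms(3,4) by (cases "xs = []") auto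
  with m assms(2) have "cpath \<K> a (xs @ idV \<K> f # ys) b"
    by (auto simp: cpath_append)
  then show ?thesis
    by (rule composableI[rotated 2]) (use * assms(2) in auto)
qed

lemma ccomp_insert_idV':
  assumes "composable \<K> \<psi> (xs @ ys)" "f \<in> Ver \<K>"
    "xs \<noteq> [] \<Longrightarrow> VTgt \<K> (last xs) = f" "ys \<noteq> [] \<Longrightarrow> VSrc \<K> (hd ys) = f"
  shows "\<psi> \<star> (xs @ idV \<K> f # ys) = \<psi> \<star> (xs @ ys)"
  using ccomp_insert_idV composable_insert_idV assms by metis

lemma composable_delete_idV:
  assumes "composable \<K> \<psi> (xs @ idV \<K> f # ys)" "f \<in> Ver \<K>" "xs @ ys \<noteq> []"
  shows "composable \<K> \<psi> (xs @ ys)"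
proof -
  from assms(1) obtain a b where *: "\<psi> \<in> Cells \<K>" "cpath \<K> a (xs @ idV \<K> f # ys) b"
    "HSrc \<K> \<psi> = concat (map (HTgt \<K>) (xs @ idV \<K> f # ys))"
    "Dom \<K> (VSrc \<K> \<psi>) = Cod \<K> a" "Dom \<K> (VTgt \<K> \<psi>) = Cod \<K> b"
    by (rule composableE)
  have "cpath \<K> a (xs @ ys) b"
    using *(2) assms(2) by (auto simp: cpath_append)
  then show ?thesis
    by (rule composableI[rotated 2]) (use * assms in auto)
qed

text \<open>The unit axioms treat a single vertical identity and a path of horizontal identities
  separately. Induction on the length deletes vertical identities one at a time until one of these
  two cases is reached.\<close>

lemma ccomp_identity_cells:
  assumes "composable \<K> \<chi> cs" "\<And>c. c \<in> set cs \<Longrightarrow> identity_cell \<K> c"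
  shows "\<chi> \<star> cs = \<chi>"
  using assms
proof (induction "length cs" arbitrary: cs rule: less_induct)
  case less
  have ne: "cs \<noteq> []" and \<chi>: "\<chi> \<in> Cells \<K>"
    using less.prems(1) by (auto elim: composableE)
  show ?case
  proof (cases "\<exists>X \<in> Obj \<K>. idV \<K> (Idt \<K> X) \<in> set cs")
    case True
    then obtain X xs ys where X: "X \<in> Obj \<K>" and cs: "cs = xs @ idV \<K> (Idt \<K> X) # ys"
      by (meson split_list)
    show ?thesis
    proof (cases "xs @ ys = []")
      case True
      \<comment> \<open>A lone vertical identity cannot be deleted, since paths in composites are
        nonempty; the unit axiom for an empty horizontal source applies instead.\<close>
      then have cs': "cs = [idV \<K> (Idt \<K> X)]" using cs by simp
      with less.prems(1) X have "HSrc \<K> \<chi> = []" "Dom \<K> (VSrc \<K> \<chi>) = X"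
        by (auto simp: composable_def)
      then show ?thesis
        using ccomp_idV[of \<chi> "HTgt \<K> \<chi>" "VSrc \<K> \<chi>" "VTgt \<K> \<chi>"] \<chi> cs'
        by (auto simp: cell_in_def)
    next
      case False
      have comp: "composable \<K> \<chi> (xs @ ys)"
        using composable_delete_idV[OF _ _ False] less.prems(1) cs X by simp
      have "\<chi> \<star> cs = \<chi> \<star> (xs @ ys)"
        using ccomp_insert_idV[OF _ comp] less.prems(1) cs X by simp
      also have "\<dots> = \<chi>"
        using less.hyps[OF _ comp] less.prems(2) cs by auto
      finally show ?thesis .
    qed
  next
    case False
    have all: "\<forall>c \<in> set cs. \<exists>J \<in> Hor \<K>. c = idH \<K> J"
      using less.prems(2) False by (auto simp: identity_cell_def)
    \<comment> \<open>A horizontal identity is determined by its target, so the path is the one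
      built from the horizontal source of \<chi>.\<close>
    have "map (idH \<K>) (concat (map (HTgt \<K>) cs)) = cs"
      using all by (induction cs) auto
    moreover have "HSrc \<K> \<chi> = concat (map (HTgt \<K>) cs)"
      using less.prems(1) by (auto elim: composableE)
    ultimately have "map (idH \<K>) (HSrc \<K> \<chi>) = cs" by simp
    moreover from this have "HSrc \<K> \<chi> \<noteq> []" using ne by auto
    ultimately show ?thesis
      using ccomp_idH[of \<chi> "HSrc \<K> \<chi>" "HTgt \<K> \<chi>" "VSrc \<K> \<chi>" "VTgt \<K> \<chi>"] \<chi>
      by (simp add: cell_in_def)
  qed
qed

section \<open>Associativity for composites arranged in blocks\<close>

lemma composable_blocks:
  assumes "list_all2 (composable \<K>) \<psi>s \<phi>ss" "cpath \<K> a \<psi>s b" "cpath \<K> f (concat \<phi>ss) g"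
    "\<psi>s \<noteq> []"
  shows "cpath \<K> (a \<cdot> f) (map2 (\<lambda>\<psi> \<phi>s. \<psi> \<star> \<phi>s) \<psi>s \<phi>ss) (b \<cdot> g)
    \<and> concat (map (HTgt \<K>) (map2 (\<lambda>\<psi> \<phi>s. \<psi> \<star> \<phi>s) \<psi>s \<phi>ss)) = concat (map (HTgt \<K>) \<psi>s)
    \<and> concat (map (HTgt \<K>) (concat \<phi>ss)) = concat (map (HSrc \<K>) \<psi>s)
    \<and> Dom \<K> a = Cod \<K> f \<and> Dom \<K> b = Cod \<K> g
    \<and> a \<in> Ver \<K> \<and> b \<in> Ver \<K> \<and> f \<in> Ver \<K> \<and> g \<in> Ver \<K>"
  using assms
proof (induction \<psi>s \<phi>ss arbitrary: a f rule: list_all2_induct)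
  case Nil
  then show ?case by simp
next
  case (Cons \<psi> \<psi>s \<phi>s \<phi>ss)
  obtain m where m: "cpath \<K> f \<phi>s m" "cpath \<K> m (concat \<phi>ss) g"
    using Cons.prems by (auto simp: cpath_append)
  note c = ccomp_cell_in[OF Cons.hyps(1) m(1)]
  have p: "\<phi>s \<noteq> []" "\<psi> \<in> Cells \<K>" "HSrc \<K> \<psi> = concat (map (HTgt \<K>) \<phi>s)"
    "Dom \<K> (VSrc \<K> \<psi>) = Cod \<K> f" "Dom \<K> (VTgt \<K> \<psi>) = Cod \<K> m"
    using Cons.hyps(1) cpath_ends[OF m(1)] by (auto simp: composable_def cell_path_def)
  have v: "f \<in> Ver \<K>" "m \<in> Ver \<K>"
    using cpath_ends[OF m(1) p(1)] cpath_Cells[OF m(1)] p(1) hd_in_set last_in_set VSrc_in VTgt_in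
    by (metis subsetD)+
  \<comment> \<open>The last block is treated apart: the induction hypothesis needs
    \<open>\<psi>s \<noteq> []\<close>, because an empty path says nothing about the domains and
    codomains of its ends.\<close>
  show ?case
  proof (cases "\<psi>s = []")
    case True
    then show ?thesis using Cons.hyps Cons.prems m c p v
      by (auto simp: cell_in_def)
  next
    case False
    then show ?thesis
      using Cons.IH[OF _ m(2) False, of "VTgt \<K> \<psi>"] Cons.hyps Cons.prems m c p v
      by (auto simp: cell_in_def)
  qed
qed

text \<open>Composability of the separate blocks does not compare the vertical morphisms where two
  blocks meet; that \<open>concat \<phi>ss\<close> is a path supplies this. Both bracketings
  demanded by the associativity axiom are then well typed.\<close>

lemma composable_ccomp:
  assumes "composable \<K> \<chi> \<psi>s" "list_all2 (composable \<K>) \<psi>s \<phi>ss" "cell_path \<K> (concat \<phi>ss)"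
  shows "composable \<K> (\<chi> \<star> \<psi>s) (concat \<phi>ss)"
    and "composable \<K> \<chi> (map2 (\<lambda>\<psi> \<phi>s. \<psi> \<star> \<phi>s) \<psi>s \<phi>ss)"
proof -
  from assms(1) obtain a b where *: "\<chi> \<in> Cells \<K>" "\<psi>s \<noteq> []" "cpath \<K> a \<psi>s b"
    "HSrc \<K> \<chi> = concat (map (HTgt \<K>) \<psi>s)"
    "Dom \<K> (VSrc \<K> \<chi>) = Cod \<K> a" "Dom \<K> (VTgt \<K> \<chi>) = Cod \<K> b"
    by (rule composableE)
  from assms(3) obtain f g where fg: "cpath \<K> f (concat \<phi>ss) g" "concat \<phi>ss \<noteq> []"
    by (auto simp: cell_path_iff)
  note B = composable_blocks[OF assms(2) *(3) fg(1) *(2)]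
  show "composable \<K> (\<chi> \<star> \<psi>s) (concat \<phi>ss)"
    by (rule composableI[OF _ fg(2,1)])
      (use B * ccomp_cell_in[OF assms(1) *(3)] in \<open>auto simp: cell_in_def\<close>)
  have "map2 (\<lambda>\<psi> \<phi>s. \<psi> \<star> \<phi>s) \<psi>s \<phi>ss \<noteq> []"
    using *(2) assms(2) by (auto simp: list_all2_iff zip_eq_Nil_iff)
  then show "composable \<K> \<chi> (map2 (\<lambda>\<psi> \<phi>s. \<psi> \<star> \<phi>s) \<psi>s \<phi>ss)"
    by (rule composableI[where f = "a \<cdot> f" and g = "b \<cdot> g", OF *(1)]) (use B * in auto)
qed

lemma ccomp_assoc':
  assumes "composable \<K> \<chi> \<psi>s" "list_all2 (composable \<K>) \<psi>s \<phi>ss" "cell_path \<K> (concat \<phi>ss)"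
  shows "(\<chi> \<star> \<psi>s) \<star> concat \<phi>ss = \<chi> \<star> (map2 (\<lambda>\<psi> \<phi>s. \<psi> \<star> \<phi>s) \<psi>s \<phi>ss)"
  using ccomp_assoc[OF assms(2) _ assms(1)] composable_ccomp[OF assms] by simp


section \<open>Identity cells of short paths, and flattening of nested composites\<close>

lemma id_path_cell:
  assumes "hpath \<K> X Ks Y" "length Ks \<le> 1"
  shows "cell_in \<K> (id_path \<K> X Ks) Ks Ks (Idt \<K> X) (Idt \<K> Y)"
    and "identity_cell \<K> (id_path \<K> X Ks)"
  using assms by (cases Ks; auto simp: id_path_def cell_in_def identity_cell_def)+

lemma id_path_ccomp:
  assumes "cell_in \<K> \<phi> Js Ks f g"
  shows "id_path \<K> (Cod \<K> f) Ks \<star> [\<phi>] = \<phi>"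
proof (cases Ks)
  case Nil
  then show ?thesis using idV_ccomp[of \<phi> Js f g] assms by (simp add: id_path_def)
next
  case (Cons K Ks')
  moreover have "length Ks \<le> 1" using assms HTgt_length[of \<phi>] by (simp add: cell_in_def)
  ultimately show ?thesis using idH_ccomp[of \<phi> Js K f g] assms by (simp add: id_path_def)
qed

text \<open>An empty \<open>HTgt \<K> c\<close> does not record its object, hence the use of the
  codomain of the vertical source. Composed after c, this cell lets c pass unchanged while other
  cells of a path are regrouped.\<close>

definition target_id :: "'c \<Rightarrow> 'c" where
  "target_id c = id_path \<K> (Cod \<K> (VSrc \<K> c)) (HTgt \<K> c)"

lemma target_id:
  assumes "c \<in> Cells \<K>"
  shows "cell_in \<K> (target_id c) (HTgt \<K> c) (HTgt \<K> c)
      (Idt \<K> (Cod \<K> (VSrc \<K> c))) (Idt \<K> (Cod \<K> (VTgt \<K> c)))"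
    and "identity_cell \<K> (target_id c)"
    and "composable \<K> (target_id c) [c]"
    and "target_id c \<star> [c] = c"
proof -
  show cell: "cell_in \<K> (target_id c) (HTgt \<K> c) (HTgt \<K> c)
      (Idt \<K> (Cod \<K> (VSrc \<K> c))) (Idt \<K> (Cod \<K> (VTgt \<K> c)))"
    and "identity_cell \<K> (target_id c)"
    using id_path_cell[OF HTgt_path HTgt_length] assms by (simp_all add: target_id_def)
  show "composable \<K> (target_id c) [c]"
    by (rule composableI) (use cell assms in \<open>auto simp: cell_in_def Cod_in\<close>)
  show "target_id c \<star> [c] = c"
    using id_path_ccomp assms by (simp add: target_id_def cell_in_def)
qed

lemma target_id_simps:
  assumes "c \<in> Cells \<K>"
  shows "target_id c \<in> Cells \<K>" "HSrc \<K> (target_id c) = HTgt \<K> c"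
    "HTgt \<K> (target_id c) = HTgt \<K> c" "VSrc \<K> (target_id c) = Idt \<K> (Cod \<K> (VSrc \<K> c))"
    "VTgt \<K> (target_id c) = Idt \<K> (Cod \<K> (VTgt \<K> c))"
  using target_id(1)[OF assms] by (simp_all add: cell_in_def)

lemma cpath_target_id:
  assumes "cpath \<K> f xs g"
  shows "cpath \<K> (Idt \<K> (Cod \<K> f)) (map target_id xs) (Idt \<K> (Cod \<K> g))"
    and "map (HTgt \<K>) (map target_id xs) = map (HTgt \<K>) xs"
    and "list_all2 (composable \<K>) (map target_id xs) (map (\<lambda>x. [x]) xs)"
    and "map2 (\<lambda>\<psi> \<phi>s. \<psi> \<star> \<phi>s) (map target_id xs) (map (\<lambda>x. [x]) xs) = xs"
proof -
  show "cpath \<K> (Idt \<K> (Cod \<K> f)) (map target_id xs) (Idt \<K> (Cod \<K> g))"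
    using assms by (induction xs arbitrary: f) (simp_all add: target_id_simps)
  have "set xs \<subseteq> Cells \<K>" using assms by (rule cpath_Cells)
  then show "map (HTgt \<K>) (map target_id xs) = map (HTgt \<K>) xs"
    and "list_all2 (composable \<K>) (map target_id xs) (map (\<lambda>x. [x]) xs)"
    and "map2 (\<lambda>\<psi> \<phi>s. \<psi> \<star> \<phi>s) (map target_id xs) (map (\<lambda>x. [x]) xs) = xs"
    by (induction xs) (simp_all add: target_id(3,4) target_id_simps)
qed

lemma identity_cellE:
  assumes "identity_cell \<K> i"
  obtains X Y where "X \<in> Obj \<K>" "Y \<in> Obj \<K>" "cell_in \<K> i (HTgt \<K> i) (HTgt \<K> i) (Idt \<K> X) (Idt \<K> Y)"
proof -
  have "\<exists>X Y. X \<in> Obj \<K> \<and> Y \<in> Obj \<K>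
    \<and> cell_in \<K> i (HTgt \<K> i) (HTgt \<K> i) (Idt \<K> X) (Idt \<K> Y)"
    using assms unfolding identity_cell_def
  proof (elim disjE bexE)
    fix X assume "X \<in> Obj \<K>" "i = idV \<K> (Idt \<K> X)"
    then show ?thesis by (intro exI[of _ X]) (simp add: cell_in_def)
  next
    fix J assume "J \<in> Hor \<K>" "i = idH \<K> J"
    then show ?thesis
      by (intro exI[of _ "Src \<K> J"] exI[of _ "Tgt \<K> J"]) (simp add: cell_in_def Src_in Tgt_in)
  qed
  then show thesis using that by blast
qed

text \<open>Put \<open>i\<close> after the block \<open>vs\<close> and \<open>target_id\<close>
  after every other cell. The resulting path consists of identity cells and is absorbed by \<chi>,
  so associativity introduces or removes the bracket around \<open>vs\<close>.\<close>

lemma ccomp_flatten: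
  assumes "composable \<K> \<chi> (us @ vs @ ws)" "identity_cell \<K> i" "composable \<K> i vs"
  shows "composable \<K> \<chi> (us @ (i \<star> vs) # ws)"
    and "\<chi> \<star> (us @ (i \<star> vs) # ws) = \<chi> \<star> (us @ vs @ ws)"
proof -
  from assms(1) obtain a b where *: "\<chi> \<in> Cells \<K>" "cpath \<K> a (us @ vs @ ws) b"
    "HSrc \<K> \<chi> = concat (map (HTgt \<K>) (us @ vs @ ws))"
    "Dom \<K> (VSrc \<K> \<chi>) = Cod \<K> a" "Dom \<K> (VTgt \<K> \<chi>) = Cod \<K> b"
    by (rule composableE)
  then obtain m n where p: "cpath \<K> a us m" "cpath \<K> m vs n" "cpath \<K> n ws b"
    by (auto simp: cpath_append)
  from assms(2) obtain X Y where XY: "X \<in> Obj \<K>" "Y \<in> Obj \<K>"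
    "cell_in \<K> i (HTgt \<K> i) (HTgt \<K> i) (Idt \<K> X) (Idt \<K> Y)"
    by (rule identity_cellE)
  have i: "Cod \<K> m = X" "Cod \<K> n = Y" "HTgt \<K> i = concat (map (HTgt \<K>) vs)" "vs \<noteq> []"
    using assms(3) XY cpath_ends[OF p(2)]
    by (auto simp: composable_def cell_path_def cell_in_def)
  define \<psi>s where "\<psi>s = map target_id us @ i # map target_id ws"
  define \<phi>ss where "\<phi>ss = map (\<lambda>x. [x]) us @ vs # map (\<lambda>x. [x]) ws"
  have cat: "concat \<phi>ss = us @ vs @ ws"
    by (simp add: \<phi>ss_def)
  have Obj: "Cod \<K> a \<in> Obj \<K>" "Cod \<K> b \<in> Obj \<K>"
    using * Dom_in VSrc_in VTgt_in by metis+
  have comp: "composable \<K> \<chi> \<psi>s"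
  proof (rule composableI[OF *(1), where f = "Idt \<K> (Cod \<K> a)" and g = "Idt \<K> (Cod \<K> b)"])
    show "cpath \<K> (Idt \<K> (Cod \<K> a)) \<psi>s (Idt \<K> (Cod \<K> b))"
      using cpath_target_id(1)[OF p(1)] cpath_target_id(1)[OF p(3)] i XY
      by (auto simp: \<psi>s_def cpath_append cell_in_def)
    show "HSrc \<K> \<chi> = concat (map (HTgt \<K>) \<psi>s)"
      using * cpath_target_id(2)[OF p(1)] cpath_target_id(2)[OF p(3)] i
      by (simp add: \<psi>s_def del: map_map)
  qed (use * Obj in \<open>auto simp: \<psi>s_def\<close>)
  have l2: "list_all2 (composable \<K>) \<psi>s \<phi>ss"
    using cpath_target_id(3)[OF p(1)] cpath_target_id(3)[OF p(3)] assms(3)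
    by (auto simp: \<psi>s_def \<phi>ss_def intro!: list_all2_appendI)
  have cp: "cell_path \<K> (concat \<phi>ss)"
    using assms(1) by (simp add: cat composable_def)
  have m2: "map2 (\<lambda>\<psi> \<phi>s. \<psi> \<star> \<phi>s) \<psi>s \<phi>ss = us @ (i \<star> vs) # ws"
    using cpath_target_id(4)[OF p(1)] cpath_target_id(4)[OF p(3)]
    by (simp add: \<psi>s_def \<phi>ss_def)
  have "\<chi> \<star> \<psi>s = \<chi>"
    by (rule ccomp_identity_cells[OF comp])
      (use assms(2) target_id(2) cpath_Cells[OF p(1)] cpath_Cells[OF p(3)] in \<open>auto simp: \<psi>s_def\<close>)
  then show "composable \<K> \<chi> (us @ (i \<star> vs) # ws)"
    and "\<chi> \<star> (us @ (i \<star> vs) # ws) = \<chi> \<star> (us @ vs @ ws)"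
    using composable_ccomp[OF comp l2 cp] ccomp_assoc'[OF comp l2 cp] m2 cat by auto
qed

section \<open>Invertible paths and factorisations\<close>

text \<open>Only horizontal cells between single horizontal morphisms are considered. These include
  the cartesian cells over identity morphisms and the horizontal identities, which make up the
  extensions along identities.\<close>

definition inverse_cells :: "'c \<Rightarrow> 'c \<Rightarrow> bool" where
  "inverse_cells p q \<longleftrightarrow> (\<exists>X Y R H. X \<in> Obj \<K> \<and> Y \<in> Obj \<K> \<and> R \<in> Hor \<K> \<and> H \<in> Hor \<K> \<and>
     cell_in \<K> p [R] [H] (Idt \<K> X) (Idt \<K> Y) \<and> cell_in \<K> q [H] [R] (Idt \<K> X) (Idt \<K> Y) \<and>
     q \<star> [p] = idH \<K> R \<and> p \<star> [q] = idH \<K> H)"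

lemma inverse_cells_sym: "inverse_cells p q \<Longrightarrow> inverse_cells q p"
  unfolding inverse_cells_def by blast

lemma list_all2_inverse_cells_sym: "list_all2 inverse_cells ps qs \<Longrightarrow> list_all2 inverse_cells qs ps"
  by (auto simp: list_all2_conv_all_nth inverse_cells_sym)

text \<open>Serves to cancel extensions: the cells of \<open>ps\<close> form singleton blocks for
  the cells of \<open>qs\<close> in the same places, and the composites are identity cells.\<close>

lemma inverse_paths:
  assumes "list_all2 inverse_cells ps qs"
  shows "cpath \<K> f ps g \<longleftrightarrow> cpath \<K> f qs g"
    and "map (HTgt \<K>) ps = map (HSrc \<K>) qs" "map (HSrc \<K>) ps = map (HTgt \<K>) qs"
    and "list_all2 (composable \<K>) qs (map (\<lambda>x. [x]) ps)"
    and "c \<in> set (map2 (\<lambda>\<psi> \<phi>s. \<psi> \<star> \<phi>s) qs (map (\<lambda>x. [x]) ps)) \<Longrightarrow> identity_cell \<K> c"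
  using assms
proof (induction arbitrary: f rule: list_all2_induct)
  case (Cons p ps q qs)
  { case 1 then show ?case using Cons by (auto simp: inverse_cells_def cell_in_def) }
  { case 2 then show ?case using Cons by (auto simp: inverse_cells_def cell_in_def) }
  { case 3 then show ?case using Cons by (auto simp: inverse_cells_def cell_in_def) }
  { case 4
    have "composable \<K> q [p]"
      using Cons(1) by (auto simp: inverse_cells_def cell_in_def intro!: composableI)
    then show ?case using Cons by auto }
  { case 5 then show ?case using Cons by (auto simp: inverse_cells_def identity_cell_def) }
qed auto

text \<open>Since the outer vertical morphisms are identities, \<chi> has vertical ends h and k
  themselves and can be composed with \<open>qs\<close>, which gives the factorisation. The other
  cancellation law forces every factorisation to be this one.\<close>

lemma weakly_cocartesian_if_inverse:
  assumes "X \<in> Obj \<K>" "Y \<in> Obj \<K>" "ps \<noteq> []" "qs \<noteq> []"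
    and ps: "cpath \<K> (Idt \<K> X) ps (Idt \<K> Y)" and qs: "cpath \<K> (Idt \<K> X) qs (Idt \<K> Y)"
    and HS: "concat (map (HSrc \<K>) ps) = concat (map (HTgt \<K>) qs)"
    and HT: "concat (map (HTgt \<K>) ps) = concat (map (HSrc \<K>) qs)"
    and qp: "\<And>\<chi>. composable \<K> \<chi> qs \<Longrightarrow> (\<chi> \<star> qs) \<star> ps = \<chi>"
    and pq: "\<And>\<chi>. composable \<K> \<chi> ps \<Longrightarrow> (\<chi> \<star> ps) \<star> qs = \<chi>"
  shows "weakly_cocartesian \<K> ps"
  unfolding weakly_cocartesian_def
proof (intro conjI allI impI)
  show "cell_path \<K> ps" using ps assms(3) by (rule cell_pathI)
  note ends = cpath_ends[OF ps assms(3)]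
  fix \<chi> Ks U V h k
  assume "vmor \<K> h (Cod \<K> (VSrc \<K> (hd ps))) U \<and> vmor \<K> k (Cod \<K> (VTgt \<K> (last ps))) V \<and>
    cell_in \<K> \<chi> (concat (map (HSrc \<K>) ps)) Ks
      (h \<cdot> VSrc \<K> (hd ps)) (k \<cdot> VTgt \<K> (last ps))"
  with assms(1,2) ends have hk: "h \<in> Ver \<K>" "Dom \<K> h = X" "k \<in> Ver \<K>" "Dom \<K> k = Y"
    and \<chi>: "cell_in \<K> \<chi> (concat (map (HSrc \<K>) ps)) Ks h k"
    by (auto simp: vmor_def)
  have c: "composable \<K> \<chi> qs"
    by (rule composableI[OF _ assms(4) qs]) (use \<chi> hk HS assms(1,2) in \<open>auto simp: cell_in_def\<close>)
  show "\<exists>!\<chi>'. cell_in \<K> \<chi>' (concat (map (HTgt \<K>) ps)) Ks h k \<and> \<chi> = \<chi>' \<star> ps"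
  proof (intro ex1I conjI)
    show "cell_in \<K> (\<chi> \<star> qs) (concat (map (HTgt \<K>) ps)) Ks h k"
      using ccomp_cell_in[OF c qs] \<chi> hk HT by (auto simp: cell_in_def)
    show "\<chi> = (\<chi> \<star> qs) \<star> ps" using qp[OF c] by simp
  next
    fix \<chi>' assume *: "cell_in \<K> \<chi>' (concat (map (HTgt \<K>) ps)) Ks h k \<and> \<chi> = \<chi>' \<star> ps"
    have "composable \<K> \<chi>' ps"
      by (rule composableI[OF _ assms(3) ps]) (use * hk assms(1,2) in \<open>auto simp: cell_in_def\<close>)
    then show "\<chi>' = \<chi> \<star> qs" using pq * by simp
  qed
qed

section \<open>Factorisation through cartesian cells, and invertibility of extensions along
  identities\<close>

lemma cartesian_factor:
  assumes "cartesian \<K> \<psi>" "cell_in \<K> \<psi> Js Ks f g" "h \<in> Ver \<K>" "k \<in> Ver \<K>"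
    "Cod \<K> h = Dom \<K> f" "Cod \<K> k = Dom \<K> g" "cell_in \<K> \<chi> Hs Ks (f \<cdot> h) (g \<cdot> k)"
  shows "\<exists>!\<phi>. cell_in \<K> \<phi> Hs Js h k \<and> \<chi> = \<psi> \<star> [\<phi>]"
proof -
  have "vmor \<K> h (Dom \<K> h) (Dom \<K> (VSrc \<K> \<psi>))" "vmor \<K> k (Dom \<K> k) (Dom \<K> (VTgt \<K> \<psi>))"
    "cell_in \<K> \<chi> Hs (HTgt \<K> \<psi>) (VSrc \<K> \<psi> \<cdot> h) (VTgt \<K> \<psi> \<cdot> k)" "HSrc \<K> \<psi> = Js"
    using assms by (auto simp: cell_in_def vmor_def)
  then show ?thesis
    using assms(1) unfolding cartesian_def by blast
qed

text \<open>The inverse is the factorisation of \<open>idH \<K> H\<close> through \<open>c\<close>.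
  The composite in the other order and \<open>idH \<K> R\<close> both factor \<open>c\<close>
  through itself, and so agree by uniqueness.\<close>

lemma horizontal_cartesian_inverse:
  assumes "cartesian \<K> c" "cell_in \<K> c [R] [H] (Idt \<K> X) (Idt \<K> Y)"
    "X \<in> Obj \<K>" "Y \<in> Obj \<K>"
  shows "\<exists>c'. inverse_cells c c'"
proof -
  have R: "R \<in> Hor \<K>" "Src \<K> R = X" "Tgt \<K> R = Y"
    and H: "H \<in> Hor \<K>" "Src \<K> H = X" "Tgt \<K> H = Y"
    using HSrc_path[of c] HTgt_path[of c] assms by (auto simp: cell_in_def)
  obtain c' where c': "cell_in \<K> c' [H] [R] (Idt \<K> X) (Idt \<K> Y)" "idH \<K> H = c \<star> [c']"
    using cartesian_factor[OF assms(1,2), of "Idt \<K> X" "Idt \<K> Y" "idH \<K> H" "[H]"] assms H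
    by (auto simp: cell_in_def)
  have cc': "composable \<K> c [c']" and c'c: "composable \<K> c' [c]"
    using assms c' by (auto simp: cell_in_def intro!: composableI)
  have *: "cell_in \<K> (c' \<star> [c]) [R] [R] (Idt \<K> X) (Idt \<K> Y)"
    using ccomp_cell_in[OF c'c, of "Idt \<K> X" "Idt \<K> Y"] assms c' by (auto simp: cell_in_def)
  have "c \<star> [c' \<star> [c]] = (c \<star> [c']) \<star> [c]"
    using ccomp_assoc'[OF cc', of "[[c]]"] c'c assms(2)
    by (auto simp: composable_def)
  also have "\<dots> = c" using c'(2) idH_ccomp assms(2) by metis
  finally have "c \<star> [c' \<star> [c]] = c" .
  moreover have "c \<star> [idH \<K> R] = c" using ccomp_idH[OF assms(2)] by simp
  moreover have "\<exists>!\<phi>. cell_in \<K> \<phi> [R] [R] (Idt \<K> X) (Idt \<K> Y) \<and> c = c \<star> [\<phi>]"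
    by (rule cartesian_factor[OF assms(1,2)]) (use assms(2-4) in auto)
  moreover have "cell_in \<K> (idH \<K> R) [R] [R] (Idt \<K> X) (Idt \<K> Y)"
    using R by (simp add: cell_in_def)
  ultimately have "c' \<star> [c] = idH \<K> R"
    using * by metis
  then have "inverse_cells c c'"
    unfolding inverse_cells_def using assms c' R H by metis
  then show ?thesis ..
qed

lemma inverse_cells_idH: "J \<in> Hor \<K> \<Longrightarrow> inverse_cells (idH \<K> J) (idH \<K> J)"
  unfolding inverse_cells_def
  by (rule exI[of _ "Src \<K> J"], rule exI[of _ "Tgt \<K> J"], rule exI[of _ J], rule exI[of _ J])
    (use idH_ccomp[of "idH \<K> J" "[J]" J] in \<open>auto simp: cell_in_def Src_in Tgt_in\<close>)

lemma cpath_idH: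
  "hpath \<K> X Js Y \<Longrightarrow> cpath \<K> (Idt \<K> X) (map (idH \<K>) Js) (Idt \<K> Y)
     \<and> list_all2 inverse_cells (map (idH \<K>) Js) (map (idH \<K>) Js)"
  by (induction Js arbitrary: X) (auto simp: inverse_cells_idH)

text \<open>A restriction along an identity is defined by a horizontal cartesian cell, hence by an
  invertible one; the remaining cells of the extension are horizontal identities. For the empty
  extension X is A.\<close>

lemma left_extension_inverse:
  assumes "left_extension \<K> (Idt \<K> A) ls" "A \<in> Obj \<K>"
  obtains X ls' where "X \<in> Obj \<K>" "cpath \<K> (Idt \<K> X) ls (Idt \<K> A)" "list_all2 inverse_cells ls ls'"
proof (cases "ls = []")
  case True
  then show ?thesis using that[of A "[]"] assms by simp
next
  case False
  then obtain X Hs H R c where *: "hpath \<K> X (Hs @ [H]) A"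
    "cell_in \<K> c [R] [H] (Idt \<K> (Src \<K> H)) (Idt \<K> A)" "cartesian \<K> c" "ls = map (idH \<K>) Hs @ [c]"
    using assms(1) unfolding left_extension_def Idt_simps(3)[OF assms(2)] by blast
  have X: "X \<in> Obj \<K>" using *(1) hpath_Obj by blast
  have H: "hpath \<K> X Hs (Src \<K> H)" "H \<in> Hor \<K>" using *(1) X by (auto simp: hpath_append')
  obtain c' where c': "inverse_cells c c'"
    using horizontal_cartesian_inverse[OF *(3,2)] assms(2) H Src_in by blast
  show ?thesis
    by (rule that[of X "map (idH \<K>) Hs @ [c']"])
      (use * X cpath_idH[OF H(1)] c' in \<open>auto simp: cpath_append cell_in_def intro!: list_all2_appendI\<close>)
qed

lemma right_extension_inverse:
  assumes "right_extension \<K> (Idt \<K> A) rs" "A \<in> Obj \<K>"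
  obtains Y rs' where "Y \<in> Obj \<K>" "cpath \<K> (Idt \<K> A) rs (Idt \<K> Y)" "list_all2 inverse_cells rs rs'"
proof (cases "rs = []")
  case True
  then show ?thesis using that[of A "[]"] assms by simp
next
  case False
  then obtain Y Hs H R c where *: "hpath \<K> A (H # Hs) Y"
    "cell_in \<K> c [R] [H] (Idt \<K> A) (Idt \<K> (Tgt \<K> H))" "cartesian \<K> c" "rs = c # map (idH \<K>) Hs"
    using assms(1) unfolding right_extension_def Idt_simps(3)[OF assms(2)] by blast
  have Y: "Y \<in> Obj \<K>" using *(1) hpath_Obj by blast
  have H: "hpath \<K> (Tgt \<K> H) Hs Y" "H \<in> Hor \<K>" using *(1) by auto
  obtain c' where c': "inverse_cells c c'"
    using horizontal_cartesian_inverse[OF *(3,2)] assms(2) H Tgt_in by blast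
  show ?thesis
    by (rule that[of Y "c' # map (idH \<K>) Hs"])
      (use * Y cpath_idH[OF H(1)] c' in \<open>auto simp: cell_in_def\<close>)
qed


section \<open>Companions and conjoints\<close>

text \<open>The identities \<open>\<eta>\<^sub>f \<odot> \<epsilon>\<^sub>f = id\<close> and \<open>\<epsilon>\<^sub>g \<odot> \<eta>\<^sub>g = id\<close> hold after
  composition with the cartesian cell by an interchange, for which \<open>\<epsilon>\<close> is
  written as \<open>id\<^sub>C \<circ> (\<epsilon>, id\<^sub>C)\<close>.\<close>

lemma companion_hcomp:
  assumes "companion \<K> f A C J \<epsilon> \<eta>"
  shows "idH \<K> J \<star> [\<eta>, \<epsilon>] = idH \<K> J"
proof -
  have f: "f \<in> Ver \<K>" "Dom \<K> f = A" "Cod \<K> f = C"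
    and \<epsilon>: "cell_in \<K> \<epsilon> [J] [] f (Idt \<K> C)" "cartesian \<K> \<epsilon>"
    and \<eta>: "cell_in \<K> \<eta> [] [J] (Idt \<K> A) f" and \<epsilon>\<eta>: "\<epsilon> \<star> [\<eta>] = idV \<K> f"
    using assms by (auto simp: companion_def vmor_def)
  have O: "A \<in> Obj \<K>" "C \<in> Obj \<K>" using f Dom_in Cod_in by auto
  have J: "J \<in> Hor \<K>" "Src \<K> J = A" "Tgt \<K> J = C"
    using HSrc_path[of \<epsilon>] \<epsilon> f O by (auto simp: cell_in_def)
  define u where "u = idV \<K> (Idt \<K> C)"
  have u: "u \<in> Cells \<K>" "HSrc \<K> u = []" "HTgt \<K> u = []" "VSrc \<K> u = Idt \<K> C"
    "VTgt \<K> u = Idt \<K> C" using O by (auto simp: u_def)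
  have c1: "composable \<K> (idH \<K> J) [\<eta>, \<epsilon>]"
    by (rule composableI[where f = "Idt \<K> A" and g = "Idt \<K> C"])
      (use \<epsilon> \<eta> J O in \<open>auto simp: cell_in_def\<close>)
  have c2: "composable \<K> \<epsilon> [idH \<K> J]"
    by (rule composableI[where f = "Idt \<K> A" and g = "Idt \<K> C"])
      (use \<epsilon> J O f in \<open>auto simp: cell_in_def\<close>)
  have c3: "composable \<K> u [\<epsilon>, u]"
    by (rule composableI[where f = f and g = "Idt \<K> C"])
      (use \<epsilon> O f u in \<open>auto simp: cell_in_def\<close>)
  have c4: "composable \<K> \<epsilon> [\<eta>]"
    by (rule composableI[where f = "Idt \<K> A" and g = "f"])
      (use \<epsilon> \<eta> O f in \<open>auto simp: cell_in_def\<close>)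
  have c5: "composable \<K> u [\<epsilon>]"
    by (rule composableI[where f = f and g = "Idt \<K> C"])
      (use \<epsilon> O f u in \<open>auto simp: cell_in_def\<close>)
  have p: "cell_path \<K> [\<eta>, \<epsilon>]" using c1 by (simp add: composable_def)
  have u\<epsilon>: "u \<star> [\<epsilon>] = \<epsilon>" using idV_ccomp[OF \<epsilon>(1)] f by (simp add: u_def)
  have e: "\<epsilon> \<star> [idH \<K> J] = \<epsilon>" using ccomp_idH[OF \<epsilon>(1)] by simp
  have "\<epsilon> \<star> [idH \<K> J \<star> [\<eta>, \<epsilon>]] = (\<epsilon> \<star> [idH \<K> J]) \<star> [\<eta>, \<epsilon>]"
    using ccomp_assoc'[OF c2, of "[[\<eta>, \<epsilon>]]"] c1 p by simp
  also have "\<dots> = \<epsilon> \<star> [\<eta>, \<epsilon>]" by (simp only: e)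
  also have "\<dots> = (u \<star> [\<epsilon>, u]) \<star> [\<eta>, \<epsilon>]"
    using ccomp_insert_idV'[of u "[\<epsilon>]" "[]" "Idt \<K> C"] c5 \<epsilon> O u u\<epsilon>
    by (simp add: u_def cell_in_def)
  also have "\<dots> = u \<star> [\<epsilon> \<star> [\<eta>], u \<star> [\<epsilon>]]"
    using ccomp_assoc'[OF c3, of "[[\<eta>], [\<epsilon>]]"] c4 c5 p by simp
  \<comment> \<open>By the companion identity the first block is \<open>idV \<K> f\<close>, which
    can be left out of the path.\<close>
  also have "\<dots> = u \<star> [\<epsilon>]"
    using ccomp_insert_idV'[of u "[]" "[\<epsilon>]" f] c5 \<epsilon> f by (simp add: \<epsilon>\<eta> u\<epsilon> cell_in_def)
  finally have "\<epsilon> \<star> [idH \<K> J \<star> [\<eta>, \<epsilon>]] = \<epsilon>" by (simp only: u\<epsilon>)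
  moreover have "cell_in \<K> (idH \<K> J \<star> [\<eta>, \<epsilon>]) [J] [J] (Idt \<K> A) (Idt \<K> C)"
    using ccomp_cell_in[OF c1, of "Idt \<K> A" "Idt \<K> C"] \<epsilon> \<eta> J O by (auto simp: cell_in_def)
  moreover have "cell_in \<K> (idH \<K> J) [J] [J] (Idt \<K> A) (Idt \<K> C)"
    using J by (auto simp: cell_in_def)
  \<comment> \<open>Both \<open>idH \<K> J\<close> and the composite factor \<epsilon> through
    itself, so uniqueness identifies them.\<close>
  moreover have "\<exists>!\<phi>. cell_in \<K> \<phi> [J] [J] (Idt \<K> A) (Idt \<K> C) \<and> \<epsilon> = \<epsilon> \<star> [\<phi>]"
    by (rule cartesian_factor[OF \<epsilon>(2,1)]) (use \<epsilon> f O in auto)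
  ultimately show ?thesis using e by metis
qed

lemma conjoint_hcomp:
  assumes "conjoint \<K> g B D J \<epsilon> \<eta>"
  shows "idH \<K> J \<star> [\<epsilon>, \<eta>] = idH \<K> J"
proof -
  have g: "g \<in> Ver \<K>" "Dom \<K> g = B" "Cod \<K> g = D"
    and \<epsilon>: "cell_in \<K> \<epsilon> [J] [] (Idt \<K> D) g" "cartesian \<K> \<epsilon>"
    and \<eta>: "cell_in \<K> \<eta> [] [J] g (Idt \<K> B)" and \<epsilon>\<eta>: "\<epsilon> \<star> [\<eta>] = idV \<K> g"
    using assms by (auto simp: conjoint_def vmor_def)
  have O: "B \<in> Obj \<K>" "D \<in> Obj \<K>" using g Dom_in Cod_in by auto
  have J: "J \<in> Hor \<K>" "Src \<K> J = D" "Tgt \<K> J = B"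
    using HSrc_path[of \<epsilon>] \<epsilon> g O by (auto simp: cell_in_def)
  define u where "u = idV \<K> (Idt \<K> D)"
  have u: "u \<in> Cells \<K>" "HSrc \<K> u = []" "HTgt \<K> u = []" "VSrc \<K> u = Idt \<K> D"
    "VTgt \<K> u = Idt \<K> D" using O by (auto simp: u_def)
  have c1: "composable \<K> (idH \<K> J) [\<epsilon>, \<eta>]"
    by (rule composableI[where f = "Idt \<K> D" and g = "Idt \<K> B"])
      (use \<epsilon> \<eta> J O in \<open>auto simp: cell_in_def\<close>)
  have c2: "composable \<K> \<epsilon> [idH \<K> J]"
    by (rule composableI[where f = "Idt \<K> D" and g = "Idt \<K> B"])
      (use \<epsilon> J O g in \<open>auto simp: cell_in_def\<close>)
  have c3: "composable \<K> u [u, \<epsilon>]"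
    by (rule composableI[where f = "Idt \<K> D" and g = g])
      (use \<epsilon> O g u in \<open>auto simp: cell_in_def\<close>)
  have c4: "composable \<K> \<epsilon> [\<eta>]"
    by (rule composableI[where f = g and g = "Idt \<K> B"])
      (use \<epsilon> \<eta> O g in \<open>auto simp: cell_in_def\<close>)
  have c5: "composable \<K> u [\<epsilon>]"
    by (rule composableI[where f = "Idt \<K> D" and g = g])
      (use \<epsilon> O g u in \<open>auto simp: cell_in_def\<close>)
  have p: "cell_path \<K> [\<epsilon>, \<eta>]" using c1 by (simp add: composable_def)
  have u\<epsilon>: "u \<star> [\<epsilon>] = \<epsilon>" using idV_ccomp[OF \<epsilon>(1)] O by (simp add: u_def)
  have e: "\<epsilon> \<star> [idH \<K> J] = \<epsilon>" using ccomp_idH[OF \<epsilon>(1)] by simp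
  have "\<epsilon> \<star> [idH \<K> J \<star> [\<epsilon>, \<eta>]] = (\<epsilon> \<star> [idH \<K> J]) \<star> [\<epsilon>, \<eta>]"
    using ccomp_assoc'[OF c2, of "[[\<epsilon>, \<eta>]]"] c1 p by simp
  also have "\<dots> = \<epsilon> \<star> [\<epsilon>, \<eta>]" by (simp only: e)
  also have "\<dots> = (u \<star> [u, \<epsilon>]) \<star> [\<epsilon>, \<eta>]"
    using ccomp_insert_idV'[of u "[]" "[\<epsilon>]" "Idt \<K> D"] c5 \<epsilon> O u u\<epsilon>
    by (simp add: u_def cell_in_def)
  also have "\<dots> = u \<star> [u \<star> [\<epsilon>], \<epsilon> \<star> [\<eta>]]"
    using ccomp_assoc'[OF c3, of "[[\<epsilon>], [\<eta>]]"] c4 c5 p by simp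
  also have "\<dots> = u \<star> [\<epsilon>]"
    using ccomp_insert_idV'[of u "[\<epsilon>]" "[]" g] c5 \<epsilon> g by (simp add: \<epsilon>\<eta> u\<epsilon> cell_in_def)
  finally have "\<epsilon> \<star> [idH \<K> J \<star> [\<epsilon>, \<eta>]] = \<epsilon>" by (simp only: u\<epsilon>)
  moreover have "cell_in \<K> (idH \<K> J \<star> [\<epsilon>, \<eta>]) [J] [J] (Idt \<K> D) (Idt \<K> B)"
    using ccomp_cell_in[OF c1, of "Idt \<K> D" "Idt \<K> B"] \<epsilon> \<eta> J O by (auto simp: cell_in_def)
  moreover have "cell_in \<K> (idH \<K> J) [J] [J] (Idt \<K> D) (Idt \<K> B)"
    using J by (auto simp: cell_in_def)
  moreover have "\<exists>!\<phi>. cell_in \<K> \<phi> [J] [J] (Idt \<K> D) (Idt \<K> B) \<and> \<epsilon> = \<epsilon> \<star> [\<phi>]"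
    by (rule cartesian_factor[OF \<epsilon>(2,1)]) (use \<epsilon> g O in auto)
  ultimately show ?thesis using e by metis
qed

text \<open>The cell \<eta> is the factorisation of \<open>idV \<K> f\<close> through \<epsilon>
  along the identity of A and f. This supplies structure cells where only the restriction is
  given.\<close>

lemma companion_exists:
  assumes "vmor \<K> f A C" "restriction \<K> J [] f (Idt \<K> C)"
  shows "\<exists>\<epsilon> \<eta>. companion \<K> f A C J \<epsilon> \<eta>"
proof -
  have f: "f \<in> Ver \<K>" "Dom \<K> f = A" "Cod \<K> f = C" "A \<in> Obj \<K>" "C \<in> Obj \<K>"
    using assms(1) Dom_in Cod_in by (auto simp: vmor_def)
  obtain \<epsilon> where \<epsilon>: "cell_in \<K> \<epsilon> [J] [] f (Idt \<K> C)" "cartesian \<K> \<epsilon>"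
    using assms(2) by (auto simp: restriction_def)
  have "\<exists>!\<phi>. cell_in \<K> \<phi> [] [J] (Idt \<K> A) f \<and> idV \<K> f = \<epsilon> \<star> [\<phi>]"
    by (rule cartesian_factor[OF \<epsilon>(2,1)]) (use f idV_cell in auto)
  then show ?thesis using assms(1) \<epsilon> unfolding companion_def by metis
qed

lemma conjoint_exists:
  assumes "vmor \<K> g B D" "restriction \<K> J [] (Idt \<K> D) g"
  shows "\<exists>\<epsilon> \<eta>. conjoint \<K> g B D J \<epsilon> \<eta>"
proof -
  have g: "g \<in> Ver \<K>" "Dom \<K> g = B" "Cod \<K> g = D" "B \<in> Obj \<K>" "D \<in> Obj \<K>"
    using assms(1) Dom_in Cod_in by (auto simp: vmor_def)
  obtain \<epsilon> where \<epsilon>: "cell_in \<K> \<epsilon> [J] [] (Idt \<K> D) g" "cartesian \<K> \<epsilon>"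
    using assms(2) by (auto simp: restriction_def)
  have "\<exists>!\<phi>. cell_in \<K> \<phi> [] [J] g (Idt \<K> B) \<and> idV \<K> g = \<epsilon> \<star> [\<phi>]"
    by (rule cartesian_factor[OF \<epsilon>(2,1)]) (use g idV_cell in auto)
  then show ?thesis using assms(1) \<epsilon> unfolding conjoint_def by metis
qed

section \<open>Factorisation through cocartesian cells, deletion of vertical identities, and
  uniqueness of restrictions\<close>

lemma cocartesian_factor:
  assumes "cocartesian \<K> [\<phi>]" "cell_in \<K> \<phi> Hs Js a b"
    "vmor \<K> h (Cod \<K> a) X" "vmor \<K> k (Cod \<K> b) Y" "cell_in \<K> \<chi> Hs Ks (h \<cdot> a) (k \<cdot> b)"
  shows "\<exists>!\<chi>'. cell_in \<K> \<chi>' Js Ks h k \<and> \<chi> = \<chi>' \<star> [\<phi>]"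
proof -
  have \<phi>: "HSrc \<K> \<phi> = Hs" "HTgt \<K> \<phi> = Js" "VSrc \<K> \<phi> = a" "VTgt \<K> \<phi> = b"
    using assms(2) by (simp_all add: cell_in_def)
  \<comment> \<open>Both extensions are taken empty, the cases p = 0 and q = 0.\<close>
  have "weakly_cocartesian \<K> ([] @ [\<phi>] @ [])"
    using assms(1) unfolding cocartesian_def left_extension_def right_extension_def by blast
  moreover have "weakly_cocartesian \<K> [\<phi>] \<longleftrightarrow> cell_path \<K> [\<phi>] \<and>
      (\<forall>\<chi> Ks X Y h k. vmor \<K> h (Cod \<K> a) X \<and> vmor \<K> k (Cod \<K> b) Y \<and>
        cell_in \<K> \<chi> Hs Ks (h \<cdot> a) (k \<cdot> b) \<longrightarrow>
        (\<exists>!\<chi>'. cell_in \<K> \<chi>' Js Ks h k \<and> \<chi> = \<chi>' \<star> [\<phi>]))"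
    unfolding weakly_cocartesian_def by (simp add: \<phi>)
  ultimately show ?thesis using assms(3-5) by simp
qed

text \<open>A vertical identity contributes nothing to the concatenated horizontal sources and
  targets and does not change the outer vertical morphisms, so both paths pose the same
  factorisation problem. In the one-sided cases this removes the placeholder next to \<psi>.\<close>

lemma weakly_cocartesian_delete_idV:
  assumes "weakly_cocartesian \<K> (us @ idV \<K> f # vs)" "f \<in> Ver \<K>" "us @ vs \<noteq> []"
  shows "weakly_cocartesian \<K> (us @ vs)"
proof -
  have p: "cell_path \<K> (us @ idV \<K> f # vs)"
    using assms(1) by (simp add: weakly_cocartesian_def)
  then obtain a b where ab: "cpath \<K> a (us @ idV \<K> f # vs) b" by (auto simp: cell_path_iff)
  then have ab': "cpath \<K> a (us @ vs) b" using assms(2) by (auto simp: cpath_append)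
  note ends = cpath_ends[OF ab] cpath_ends[OF ab' assms(3)]
  have ver: "a \<in> Ver \<K>" "b \<in> Ver \<K>"
    using ends(2) cpath_Cells[OF ab'] assms(3) VSrc_in VTgt_in hd_in_set last_in_set
    by (metis subsetD)+
  have eq: "\<chi> \<star> (us @ idV \<K> f # vs) = \<chi> \<star> (us @ vs)"
    if "cell_in \<K> \<chi> (concat (map (HTgt \<K>) (us @ vs))) Ks h k"
      "vmor \<K> h (Cod \<K> a) X" "vmor \<K> k (Cod \<K> b) Y" for \<chi> Ks h k X Y
  proof -
    have "composable \<K> \<chi> (us @ vs)"
      by (rule composableI[OF _ assms(3) ab']) (use that in \<open>auto simp: cell_in_def vmor_def\<close>)
    moreover have "composable \<K> \<chi> (us @ idV \<K> f # vs)"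
      by (rule composableI[OF _ _ ab]) (use that assms(2) in \<open>auto simp: cell_in_def vmor_def\<close>)
    ultimately show ?thesis using ccomp_insert_idV assms(2) by simp
  qed
  show ?thesis
    unfolding weakly_cocartesian_def
  proof (intro conjI allI impI)
    show "cell_path \<K> (us @ vs)" using ab' assms(3) by (rule cell_pathI)
    fix \<chi> Ks X Y h k
    assume "vmor \<K> h (Cod \<K> (VSrc \<K> (hd (us @ vs)))) X \<and>
      vmor \<K> k (Cod \<K> (VTgt \<K> (last (us @ vs)))) Y \<and>
      cell_in \<K> \<chi> (concat (map (HSrc \<K>) (us @ vs))) Ks
        (h \<cdot> VSrc \<K> (hd (us @ vs))) (k \<cdot> VTgt \<K> (last (us @ vs)))"
    with ends have *: "vmor \<K> h (Cod \<K> a) X" "vmor \<K> k (Cod \<K> b) Y"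
      "cell_in \<K> \<chi> (concat (map (HSrc \<K>) (us @ vs))) Ks (h \<cdot> a) (k \<cdot> b)"
      by auto
    have "\<exists>!\<chi>'. cell_in \<K> \<chi>' (concat (map (HTgt \<K>) (us @ idV \<K> f # vs))) Ks h k
        \<and> \<chi> = \<chi>' \<star> (us @ idV \<K> f # vs)"
      using assms(1) * ends assms(2) unfolding weakly_cocartesian_def by simp
    then have "\<exists>!\<chi>'. cell_in \<K> \<chi>' (concat (map (HTgt \<K>) (us @ vs))) Ks h k
        \<and> \<chi> = \<chi>' \<star> (us @ idV \<K> f # vs)"
      using assms(2) by simp
    then show "\<exists>!\<chi>'. cell_in \<K> \<chi>' (concat (map (HTgt \<K>) (us @ vs))) Ks h k
        \<and> \<chi> = \<chi>' \<star> (us @ vs)"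
      using eq[OF _ *(1,2)] by metis
  qed
qed

lemma cocartesian_delete_idV:
  assumes "cocartesian \<K> (us @ idV \<K> f # vs)" "f \<in> Ver \<K>" "us @ vs \<noteq> []"
  shows "cocartesian \<K> (us @ vs)"
proof -
  from assms(1) obtain a b where ab: "cpath \<K> a (us @ idV \<K> f # vs) b"
    by (auto simp: cocartesian_def cell_path_iff)
  then have ab': "cpath \<K> a (us @ vs) b" using assms(2) by (auto simp: cpath_append)
  note ends = cpath_ends[OF ab] cpath_ends[OF ab' assms(3)]
  have "weakly_cocartesian \<K> (ls @ (us @ vs) @ rs)"
    if "left_extension \<K> a ls" "right_extension \<K> b rs" for ls rs
  proof -
    have "weakly_cocartesian \<K> (ls @ (us @ idV \<K> f # vs) @ rs)"
      using assms(1) ends that by (simp add: cocartesian_def)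
    moreover have "(ls @ us) @ vs @ rs \<noteq> []" using assms(3) by auto
    ultimately show ?thesis
      using weakly_cocartesian_delete_idV[of "ls @ us" f "vs @ rs"] assms(2) by simp
  qed
  then show ?thesis
    unfolding cocartesian_def using ends cell_pathI[OF ab' assms(3)] by auto
qed

text \<open>The two cartesian cells factor through each other, and uniqueness against the identity
  makes the factorisations mutually inverse.\<close>

lemma cartesian_hiso:
  assumes "cartesian \<K> \<psi>" "cell_in \<K> \<psi> [J] Ks f g" "cartesian \<K> \<psi>'" "cell_in \<K> \<psi>' [J'] Ks f g"
    and "hmor \<K> J A B" "hmor \<K> J' A B"
  shows "hiso \<K> J J'"
proof -
  have O: "A \<in> Obj \<K>" "B \<in> Obj \<K>" using assms(5) Src_in Tgt_in by (auto simp: hmor_def)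
  have fg: "f \<in> Ver \<K>" "Dom \<K> f = A" "g \<in> Ver \<K>" "Dom \<K> g = B"
    using HSrc_path[of \<psi>] assms(2,5) VSrc_in VTgt_in by (auto simp: cell_in_def hmor_def)
  have ex: "\<exists>\<alpha>. cell_in \<K> \<alpha> [L] [L'] (Idt \<K> A) (Idt \<K> B) \<and> \<kappa> = \<kappa>' \<star> [\<alpha>]"
    if "cartesian \<K> \<kappa>'" "cell_in \<K> \<kappa> [L] Ks f g" "cell_in \<K> \<kappa>' [L'] Ks f g" for \<kappa> \<kappa>' L L'
    using cartesian_factor[OF that(1,3), of "Idt \<K> A" "Idt \<K> B" \<kappa> "[L]"] that(2) fg O
    by (simp add: ex1_implies_ex)
  \<comment> \<open>Stated for an arbitrary pair of cells, so that exchanging their roles gives both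
    inverse laws.\<close>
  have inv: "\<beta> \<star> [\<alpha>] = idH \<K> L"
    if L: "hmor \<K> L A B" and \<kappa>: "cartesian \<K> \<kappa>" "cell_in \<K> \<kappa> [L] Ks f g"
      and \<alpha>: "cell_in \<K> \<alpha> [L] [L'] (Idt \<K> A) (Idt \<K> B)" "\<kappa> = \<kappa>' \<star> [\<alpha>]"
      and \<beta>: "cell_in \<K> \<beta> [L'] [L] (Idt \<K> A) (Idt \<K> B)" "\<kappa>' = \<kappa> \<star> [\<beta>]" for \<kappa> \<kappa>' L L' \<alpha> \<beta>
  proof -
    have c1: "composable \<K> \<beta> [\<alpha>]"
      by (rule composableI[where f = "Idt \<K> A" and g = "Idt \<K> B"])
        (use \<alpha>(1) \<beta>(1) O in \<open>simp_all add: cell_in_def\<close>)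
    have c2: "composable \<K> \<kappa> [\<beta>]"
      by (rule composableI[where f = "Idt \<K> A" and g = "Idt \<K> B"])
        (use \<kappa>(2) \<beta>(1) O fg in \<open>simp_all add: cell_in_def\<close>)
    have "\<kappa> \<star> [\<beta> \<star> [\<alpha>]] = (\<kappa> \<star> [\<beta>]) \<star> [\<alpha>]"
      using ccomp_assoc'[OF c2, of "[[\<alpha>]]"] c1 by (simp add: composable_def)
    then have "\<kappa> \<star> [\<beta> \<star> [\<alpha>]] = \<kappa>" by (simp only: \<alpha>(2)[symmetric] \<beta>(2)[symmetric])
    moreover have "\<kappa> \<star> [idH \<K> L] = \<kappa>" using ccomp_idH[OF \<kappa>(2)] by simp
    moreover have "cell_in \<K> (\<beta> \<star> [\<alpha>]) [L] [L] (Idt \<K> A) (Idt \<K> B)"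
      using ccomp_cell_in[OF c1, of "Idt \<K> A" "Idt \<K> B"] \<alpha>(1) \<beta>(1) O by (simp add: cell_in_def)
    moreover have "cell_in \<K> (idH \<K> L) [L] [L] (Idt \<K> A) (Idt \<K> B)"
      using idH_cell[OF L] .
    moreover have "\<exists>!\<gamma>. cell_in \<K> \<gamma> [L] [L] (Idt \<K> A) (Idt \<K> B) \<and> \<kappa> = \<kappa> \<star> [\<gamma>]"
      by (rule cartesian_factor[OF \<kappa>]) (use \<kappa>(2) fg O in simp_all)
    ultimately show ?thesis by metis
  qed
  obtain \<alpha> where \<alpha>: "cell_in \<K> \<alpha> [J] [J'] (Idt \<K> A) (Idt \<K> B)" "\<psi> = \<psi>' \<star> [\<alpha>]"
    using ex[OF assms(3,2,4)] by blast
  obtain \<beta> where \<beta>: "cell_in \<K> \<beta> [J'] [J] (Idt \<K> A) (Idt \<K> B)" "\<psi>' = \<psi> \<star> [\<beta>]"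
    using ex[OF assms(1,4,2)] by blast
  have "\<beta> \<star> [\<alpha>] = idH \<K> J" by (rule inv[OF assms(5,1,2) \<alpha> \<beta>])
  moreover have "\<alpha> \<star> [\<beta>] = idH \<K> J'" by (rule inv[OF assms(6,3,4) \<beta> \<alpha>])
  ultimately show ?thesis
    unfolding hiso_def using assms(5,6) \<alpha>(1) \<beta>(1) by blast
qed

end

section \<open>Restrictions and horizontal composites\<close>

text \<open>
  Here \<open>Fs\<close> is the companion of \<open>f\<close> with structure cells \<open>\<epsilon>\<close>, \<open>\<eta>\<close>, and \<open>Gs\<close> is the conjoint
  of \<open>g\<close> with structure cells \<open>\<delta>\<close>, \<open>\<theta>\<close>; either may also be the empty path, which
  covers the one-sided case.
\<close>

locale restriction_setting = augmented_virtual_double_category \<K>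
  for \<K> :: "('o, 'v, 'h, 'c) avdc" (structure) +
  fixes A B C D :: 'o and f g :: 'v and Fs Gs Ks :: "'h list" and \<epsilon> \<eta> \<delta> \<theta> :: 'c
  assumes f: "vmor \<K> f A C" and g: "vmor \<K> g B D"
    and \<epsilon>: "cell_in \<K> \<epsilon> Fs [] f (Idt \<K> C)" and \<eta>: "cell_in \<K> \<eta> [] Fs (Idt \<K> A) f"
    and \<epsilon>\<eta>: "\<epsilon> \<star> [\<eta>] = idV \<K> f" and \<eta>\<epsilon>: "id_path \<K> A Fs \<star> [\<eta>, \<epsilon>] = id_path \<K> A Fs"
    and \<delta>: "cell_in \<K> \<delta> Gs [] (Idt \<K> D) g" and \<theta>: "cell_in \<K> \<theta> [] Gs g (Idt \<K> B)"
    and \<delta>\<theta>: "\<delta> \<star> [\<theta>] = idV \<K> g" and \<theta>\<delta>: "id_path \<K> D Gs \<star> [\<delta>, \<theta>] = id_path \<K> D Gs"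
    and Ks: "hpath \<K> C Ks D" "length Ks \<le> 1"
begin

lemma vertical [simp]:
  "f \<in> Ver \<K>" "Dom \<K> f = A" "Cod \<K> f = C" "g \<in> Ver \<K>" "Dom \<K> g = B" "Cod \<K> g = D"
  "A \<in> Obj \<K>" "B \<in> Obj \<K>" "C \<in> Obj \<K>" "D \<in> Obj \<K>"
  using f g Dom_in Cod_in by (auto simp: vmor_def)

lemma structure_cells [simp]:
  "\<epsilon> \<in> Cells \<K>" "HSrc \<K> \<epsilon> = Fs" "HTgt \<K> \<epsilon> = []" "VSrc \<K> \<epsilon> = f" "VTgt \<K> \<epsilon> = Idt \<K> C"
  "\<eta> \<in> Cells \<K>" "HSrc \<K> \<eta> = []" "HTgt \<K> \<eta> = Fs" "VSrc \<K> \<eta> = Idt \<K> A" "VTgt \<K> \<eta> = f"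
  "\<delta> \<in> Cells \<K>" "HSrc \<K> \<delta> = Gs" "HTgt \<K> \<delta> = []" "VSrc \<K> \<delta> = Idt \<K> D" "VTgt \<K> \<delta> = g"
  "\<theta> \<in> Cells \<K>" "HSrc \<K> \<theta> = []" "HTgt \<K> \<theta> = Gs" "VSrc \<K> \<theta> = g" "VTgt \<K> \<theta> = Idt \<K> B"
  using \<epsilon> \<eta> \<delta> \<theta> by (auto simp: cell_in_def)

lemma hpath_Fs: "hpath \<K> A Fs C" "length Fs \<le> 1" and hpath_Gs: "hpath \<K> D Gs B" "length Gs \<le> 1"
  using HTgt_path[of \<eta>] HTgt_path[of \<theta>] HTgt_length[of \<eta>] HTgt_length[of \<theta>] by auto

abbreviation "i\<^sub>K \<equiv> id_path \<K> C Ks"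

lemma id_path_cells [simp]:
  "i\<^sub>K \<in> Cells \<K>" "HSrc \<K> i\<^sub>K = Ks" "HTgt \<K> i\<^sub>K = Ks" "VSrc \<K> i\<^sub>K = Idt \<K> C" "VTgt \<K> i\<^sub>K = Idt \<K> D"
  "id_path \<K> A Fs \<in> Cells \<K>" "HSrc \<K> (id_path \<K> A Fs) = Fs" "HTgt \<K> (id_path \<K> A Fs) = Fs"
  "VSrc \<K> (id_path \<K> A Fs) = Idt \<K> A" "VTgt \<K> (id_path \<K> A Fs) = Idt \<K> C"
  "id_path \<K> D Gs \<in> Cells \<K>" "HSrc \<K> (id_path \<K> D Gs) = Gs" "HTgt \<K> (id_path \<K> D Gs) = Gs"
  "VSrc \<K> (id_path \<K> D Gs) = Idt \<K> D" "VTgt \<K> (id_path \<K> D Gs) = Idt \<K> B"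
  "identity_cell \<K> i\<^sub>K" "identity_cell \<K> (id_path \<K> A Fs)" "identity_cell \<K> (id_path \<K> D Gs)"
  using id_path_cell[OF Ks] id_path_cell[OF hpath_Fs] id_path_cell[OF hpath_Gs]
  by (auto simp: cell_in_def)

text \<open>The given cell \<open>\<epsilon> \<odot> i\<^sub>K \<odot> \<delta>\<close> as one
  composite of three cells, a form to which block associativity applies directly;
  \<open>E_eq_hcomp\<close> relates it to the iterated horizontal composite.\<close>

definition E :: 'c where
  "E = i\<^sub>K \<star> [\<epsilon>, i\<^sub>K, \<delta>]"

lemma composable_E: "composable \<K> i\<^sub>K [\<epsilon>, i\<^sub>K, \<delta>]"
  by (rule composableI[where f = f and g = g]) auto

lemma E_cell: "cell_in \<K> E (Fs @ Ks @ Gs) Ks f g"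
  using ccomp_cell_in[OF composable_E, of f g] by (auto simp: E_def cell_in_def)

text \<open>By blocks the composite becomes \<open>i\<^sub>K\<close> after \<chi> flanked by two
  vertical identities, which drop out. The cells a and b are kept general because the lemma is
  applied both to \<eta>, \<theta> and to their composites with vertical identity cells.\<close>

lemma E_ccomp:
  assumes "cell_in \<K> a [] Fs h p" "cell_in \<K> \<chi> Hs Ks p q" "cell_in \<K> b [] Gs q k"
    and "Cod \<K> h = A" "Cod \<K> p = C" "Cod \<K> q = D" "Cod \<K> k = B"
    and "\<epsilon> \<star> [a] = idV \<K> p" "\<delta> \<star> [b] = idV \<K> q"
  shows "E \<star> [a, \<chi>, b] = \<chi>"
proof -
  have pq: "p \<in> Ver \<K>" "q \<in> Ver \<K>" using assms(2) Cells_simps by (auto simp: cell_in_def)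
  have "composable \<K> \<epsilon> [a]"
    by (rule composableI[where f = h and g = p]) (use assms in \<open>simp_all add: cell_in_def\<close>)
  moreover have \<chi>: "composable \<K> i\<^sub>K [\<chi>]"
    by (rule composableI[where f = p and g = q]) (use assms in \<open>simp_all add: cell_in_def\<close>)
  moreover have "composable \<K> \<delta> [b]"
    by (rule composableI[where f = q and g = k]) (use assms in \<open>simp_all add: cell_in_def\<close>)
  moreover have "cell_path \<K> [a, \<chi>, b]"
    using assms by (auto simp: cell_in_def cell_path_def)
  ultimately have "E \<star> [a, \<chi>, b] = i\<^sub>K \<star> [idV \<K> p, i\<^sub>K \<star> [\<chi>], idV \<K> q]"
    using ccomp_assoc'[OF composable_E, of "[[a], [\<chi>], [b]]"] by (simp add: assms(8,9) E_def)
  also have "i\<^sub>K \<star> [\<chi>] = \<chi>"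
    using id_path_ccomp[OF assms(2)] assms(5) by simp
  also have "i\<^sub>K \<star> [idV \<K> p, \<chi>, idV \<K> q] = i\<^sub>K \<star> [idV \<K> p, \<chi>]"
    using ccomp_insert_idV'[of i\<^sub>K "[idV \<K> p, \<chi>]" "[]" q]
      composable_insert_idV[of i\<^sub>K "[]" "[\<chi>]" p] \<chi> assms(2) pq
    by (simp add: cell_in_def)
  also have "\<dots> = i\<^sub>K \<star> [\<chi>]"
    using ccomp_insert_idV'[of i\<^sub>K "[]" "[\<chi>]" p] \<chi> assms(2) pq
    by (simp add: cell_in_def)
  also have "\<dots> = \<chi>"
    using id_path_ccomp[OF assms(2)] assms(5) by simp
  finally show ?thesis .
qed

text \<open>Expanding \<open>E\<close> brings \<eta>, \<epsilon> and \<delta>, \<theta> next to each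
  other. Each pair may be bracketed under an identity cell, and the bracket is again that identity
  by \<open>\<eta>\<epsilon>\<close> and \<open>\<theta>\<delta>\<close>; only identity cells
  remain. The paths \<open>us\<close> and \<open>ws\<close> make room for extensions.\<close>

lemma ccomp_E:
  assumes "\<chi> \<in> Cells \<K>" "cpath \<K> x us (Idt \<K> A)" "cpath \<K> (Idt \<K> B) ws y"
    and "\<And>c. c \<in> set us \<union> set ws \<Longrightarrow> identity_cell \<K> c"
    and "HSrc \<K> \<chi> = concat (map (HTgt \<K>) us) @ Fs @ Ks @ Gs @ concat (map (HTgt \<K>) ws)"
    and "Dom \<K> (VSrc \<K> \<chi>) = Cod \<K> x" "Dom \<K> (VTgt \<K> \<chi>) = Cod \<K> y"
  shows "\<chi> \<star> (us @ [\<eta>, E, \<theta>] @ ws) = \<chi>"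
proof -
  have c1: "composable \<K> \<chi> (us @ [\<eta>, \<epsilon>] @ [i\<^sub>K, \<delta>, \<theta>] @ ws)"
    by (rule composableI[where f = x and g = y]) (use assms in \<open>auto simp: cpath_append\<close>)
  have F: "composable \<K> (id_path \<K> A Fs) [\<eta>, \<epsilon>]"
    by (rule composableI[where f = "Idt \<K> A" and g = "Idt \<K> C"]) auto
  have G: "composable \<K> (id_path \<K> D Gs) [\<delta>, \<theta>]"
    by (rule composableI[where f = "Idt \<K> D" and g = "Idt \<K> B"]) auto
  have "\<chi> \<star> (us @ [\<eta>, E, \<theta>] @ ws) = \<chi> \<star> (us @ [\<eta>, \<epsilon>] @ [i\<^sub>K, \<delta>, \<theta>] @ ws)"
    using ccomp_flatten(2)[of \<chi> "us @ [\<eta>]" "[\<epsilon>, i\<^sub>K, \<delta>]" "\<theta> # ws" i\<^sub>K] c1 composable_E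
    by (simp add: E_def)
  also have "\<dots> = \<chi> \<star> ((us @ [id_path \<K> A Fs, i\<^sub>K]) @ [\<delta>, \<theta>] @ ws)"
    using ccomp_flatten(2)[OF c1 _ F] \<eta>\<epsilon> by simp
  also have "\<dots> = \<chi> \<star> (us @ [id_path \<K> A Fs, i\<^sub>K, id_path \<K> D Gs] @ ws)"
    using ccomp_flatten(2)[OF _ _ G, of \<chi> "us @ [id_path \<K> A Fs, i\<^sub>K]" ws]
      ccomp_flatten(1)[OF c1 _ F] \<eta>\<epsilon> \<theta>\<delta> by simp
  also have "\<dots> = \<chi>"
  proof (rule ccomp_identity_cells)
    show "composable \<K> \<chi> (us @ [id_path \<K> A Fs, i\<^sub>K, id_path \<K> D Gs] @ ws)"
      by (rule composableI[where f = x and g = y]) (use assms in \<open>auto simp: cpath_append\<close>)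
  qed (use assms(4) in auto)
  finally show ?thesis .
qed

end

section \<open>The equivalence of the three conditions on \<phi> and \<psi>\<close>

locale restriction_composite = restriction_setting \<K> A B C D f g Fs Gs Ks \<epsilon> \<eta> \<delta> \<theta>
  for \<K> :: "('o, 'v, 'h, 'c) avdc" (structure) and A B C D f g Fs Gs Ks \<epsilon> \<eta> \<delta> \<theta> +
  fixes J :: 'h and \<phi> \<psi> :: 'c
  assumes J: "hmor \<K> J A B"
    and \<phi>: "cell_in \<K> \<phi> (Fs @ Ks @ Gs) [J] (Idt \<K> A) (Idt \<K> B)"
    and \<psi>: "cell_in \<K> \<psi> [J] Ks f g"
    and E_eq: "E = \<psi> \<star> [\<phi>]"
begin

lemma J_simps [simp]: "J \<in> Hor \<K>" "Src \<K> J = A" "Tgt \<K> J = B"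
  using J by (auto simp: hmor_def)

lemma phi_psi_simps [simp]:
  "\<phi> \<in> Cells \<K>" "HSrc \<K> \<phi> = Fs @ Ks @ Gs" "HTgt \<K> \<phi> = [J]" "VSrc \<K> \<phi> = Idt \<K> A" "VTgt \<K> \<phi> = Idt \<K> B"
  "\<psi> \<in> Cells \<K>" "HSrc \<K> \<psi> = [J]" "HTgt \<K> \<psi> = Ks" "VSrc \<K> \<psi> = f" "VTgt \<K> \<psi> = g"
  using \<phi> \<psi> by (auto simp: cell_in_def)

lemma composable_basic:
  "composable \<K> \<psi> [\<phi>]" "composable \<K> \<phi> [\<eta>, \<psi>, \<theta>]" "composable \<K> \<eta> [idV \<K> (Idt \<K> A)]"
  "composable \<K> \<theta> [idV \<K> (Idt \<K> B)]"
  by (auto intro!: composableI)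

lemma ccomp_basic:
  "\<eta> \<star> [idV \<K> (Idt \<K> A)] = \<eta>" "\<theta> \<star> [idV \<K> (Idt \<K> B)] = \<theta>"
  using ccomp_idV[OF \<eta>] ccomp_idV[OF \<theta>] by auto

text \<open>Composing \<open>\<phi>\<close> with vertical identity cells on both sides turns it into a path of three
  blocks that matches \<open>(\<eta>, \<psi>, \<theta>)\<close>, so that associativity applies.\<close>

lemma ccomp_section_retraction:
  assumes inv: "list_all2 inverse_cells ls ls'" "list_all2 inverse_cells rs rs'"
    and path: "cpath \<K> x ls (Idt \<K> A)" "cpath \<K> (Idt \<K> B) rs y"
    and comp: "composable \<K> \<chi> (ls' @ [\<eta>, \<psi>, \<theta>] @ rs')"
  shows "(\<chi> \<star> (ls' @ [\<eta>, \<psi>, \<theta>] @ rs')) \<star> (ls @ [\<phi>] @ rs) = \<chi>"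
proof -
  define P where "P = ls @ [idV \<K> (Idt \<K> A), \<phi>, idV \<K> (Idt \<K> B)] @ rs"
  define Q where "Q = ls' @ [\<eta>, \<psi>, \<theta>] @ rs'"
  define \<phi>ss where "\<phi>ss = map (\<lambda>x. [x]) ls @ [[idV \<K> (Idt \<K> A)], [\<phi>], [idV \<K> (Idt \<K> B)]] @ map (\<lambda>x. [x]) rs"
  define us where "us = map2 (\<lambda>\<psi> \<phi>s. \<psi> \<star> \<phi>s) ls' (map (\<lambda>x. [x]) ls)"
  define ws where "ws = map2 (\<lambda>\<psi> \<phi>s. \<psi> \<star> \<phi>s) rs' (map (\<lambda>x. [x]) rs)"
  have len: "length ls' = length ls" "length rs' = length rs"
    using inv by (simp_all add: list_all2_lengthD)
  have cat: "concat \<phi>ss = P" by (simp add: \<phi>ss_def P_def)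
  have P: "cpath \<K> x P y" "P \<noteq> []"
    using path by (auto simp: P_def cpath_append)
  have Q: "cpath \<K> x Q y"
    using path inverse_paths(1)[OF inv(1)] inverse_paths(1)[OF inv(2)]
    by (auto simp: Q_def cpath_append)
  have cQ: "composable \<K> \<chi> Q" using comp by (simp add: Q_def)
  have l2: "list_all2 (composable \<K>) Q \<phi>ss"
    using inverse_paths(4)[OF inv(1)] inverse_paths(4)[OF inv(2)] composable_basic
    by (auto simp: Q_def \<phi>ss_def intro!: list_all2_appendI)
  have cp: "cell_path \<K> (concat \<phi>ss)" using cell_pathI[OF P] by (simp add: cat)
  have m2: "map2 (\<lambda>\<psi> \<phi>s. \<psi> \<star> \<phi>s) Q \<phi>ss = us @ [\<eta>, E, \<theta>] @ ws"
    using len by (simp add: Q_def \<phi>ss_def us_def ws_def ccomp_basic E_eq)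
  have "composable \<K> \<chi> (us @ [\<eta>, E, \<theta>] @ ws)"
    using composable_ccomp(2)[OF cQ l2 cp] m2 by simp
  \<comment> \<open>The outer morphisms of the regrouped path are read off from its composability
    rather than computed from x and y.\<close>
  then obtain x' y' where xy: "cpath \<K> x' (us @ [\<eta>, E, \<theta>] @ ws) y'"
      "HSrc \<K> \<chi> = concat (map (HTgt \<K>) (us @ [\<eta>, E, \<theta>] @ ws))"
      "Dom \<K> (VSrc \<K> \<chi>) = Cod \<K> x'" "Dom \<K> (VTgt \<K> \<chi>) = Cod \<K> y'" "\<chi> \<in> Cells \<K>"
    by (rule composableE)
  have id: "identity_cell \<K> c" if "c \<in> set us \<union> set ws" for c
    using that inverse_paths(5)[OF inv(1)] inverse_paths(5)[OF inv(2)] by (auto simp: us_def ws_def)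
  have cP: "composable \<K> (\<chi> \<star> Q) P"
    using composable_ccomp(1)[OF cQ l2 cp] by (simp add: cat)
  \<comment> \<open>The two padding identities are removed one after the other, and each removal
    needs its own composability.\<close>
  have c1: "composable \<K> (\<chi> \<star> Q) (ls @ [\<phi>, idV \<K> (Idt \<K> B)] @ rs)"
    using composable_delete_idV[of "\<chi> \<star> Q" ls "Idt \<K> A" "[\<phi>, idV \<K> (Idt \<K> B)] @ rs"] cP
    by (simp add: P_def)
  have c2: "composable \<K> (\<chi> \<star> Q) (ls @ [\<phi>] @ rs)"
    using composable_delete_idV[of "\<chi> \<star> Q" "ls @ [\<phi>]" "Idt \<K> B" rs] c1 by simp
  have "(\<chi> \<star> Q) \<star> (ls @ [\<phi>] @ rs) = (\<chi> \<star> Q) \<star> (ls @ [\<phi>, idV \<K> (Idt \<K> B)] @ rs)"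
    using ccomp_insert_idV[of "Idt \<K> B" "\<chi> \<star> Q" "ls @ [\<phi>]" rs] c1 c2 by simp
  also have "\<dots> = (\<chi> \<star> Q) \<star> P"
    using ccomp_insert_idV[of "Idt \<K> A" "\<chi> \<star> Q" ls "[\<phi>, idV \<K> (Idt \<K> B)] @ rs"] c1 cP
    by (simp add: P_def)
  also have "\<dots> = \<chi> \<star> (us @ [\<eta>, E, \<theta>] @ ws)"
    using ccomp_assoc'[OF cQ l2 cp] m2 cat by simp
  also have "\<dots> = \<chi>"
  proof (rule ccomp_E[of \<chi> x' us ws y'])
    show "cpath \<K> x' us (Idt \<K> A)" "cpath \<K> (Idt \<K> B) ws y'"
      using xy(1) E_cell by (auto simp: cpath_append cell_in_def)
  qed (use xy E_cell id in \<open>auto simp: cell_in_def\<close>)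
  finally show ?thesis by (simp add: Q_def)
qed

text \<open>Here (\<eta>, \<psi>, \<theta>) is a single block for \<phi>, with composite
  \<open>idH \<K> J\<close> by hypothesis. The extensions cancel to identity cells as well, and
  \<chi> absorbs them all.\<close>

lemma ccomp_retraction_section:
  assumes inv: "list_all2 inverse_cells ls ls'" "list_all2 inverse_cells rs rs'"
    and path: "cpath \<K> x ls (Idt \<K> A)" "cpath \<K> (Idt \<K> B) rs y"
    and comp: "composable \<K> \<chi> (ls @ [\<phi>] @ rs)"
    and retr: "\<phi> \<star> [\<eta>, \<psi>, \<theta>] = idH \<K> J"
  shows "(\<chi> \<star> (ls @ [\<phi>] @ rs)) \<star> (ls' @ [\<eta>, \<psi>, \<theta>] @ rs') = \<chi>"
proof -
  define P where "P = ls @ [\<phi>] @ rs"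
  define Q where "Q = ls' @ [\<eta>, \<psi>, \<theta>] @ rs'"
  define \<phi>ss where "\<phi>ss = map (\<lambda>x. [x]) ls' @ [[\<eta>, \<psi>, \<theta>]] @ map (\<lambda>x. [x]) rs'"
  define us where "us = map2 (\<lambda>\<psi> \<phi>s. \<psi> \<star> \<phi>s) ls (map (\<lambda>x. [x]) ls')"
  define ws where "ws = map2 (\<lambda>\<psi> \<phi>s. \<psi> \<star> \<phi>s) rs (map (\<lambda>x. [x]) rs')"
  note inv' = list_all2_inverse_cells_sym[OF inv(1)] list_all2_inverse_cells_sym[OF inv(2)]
  have len: "length ls' = length ls" "length rs' = length rs"
    using inv by (simp_all add: list_all2_lengthD)
  have cat: "concat \<phi>ss = Q" by (simp add: \<phi>ss_def Q_def)
  have Q: "cpath \<K> x Q y" "Q \<noteq> []"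
    using path inverse_paths(1)[OF inv(1)] inverse_paths(1)[OF inv(2)]
    by (auto simp: Q_def cpath_append)
  have cP: "composable \<K> \<chi> P" using comp by (simp add: P_def)
  have l2: "list_all2 (composable \<K>) P \<phi>ss"
    using inverse_paths(4)[OF inv'(1)] inverse_paths(4)[OF inv'(2)] composable_basic
    by (auto simp: P_def \<phi>ss_def intro!: list_all2_appendI)
  have cp: "cell_path \<K> (concat \<phi>ss)" using cell_pathI[OF Q] by (simp add: cat)
  have m2: "map2 (\<lambda>\<psi> \<phi>s. \<psi> \<star> \<phi>s) P \<phi>ss = us @ [idH \<K> J] @ ws"
    using len by (simp add: P_def \<phi>ss_def us_def ws_def retr)
  have id: "identity_cell \<K> c" if "c \<in> set us \<union> set ws" for c
    using that inverse_paths(5)[OF inv'(1)] inverse_paths(5)[OF inv'(2)] by (auto simp: us_def ws_def)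
  have idJ: "identity_cell \<K> (idH \<K> J)" using J by (auto simp: identity_cell_def hmor_def)
  have "\<chi> \<star> (us @ [idH \<K> J] @ ws) = \<chi>"
  proof (rule ccomp_identity_cells)
    show "composable \<K> \<chi> (us @ [idH \<K> J] @ ws)"
      using composable_ccomp(2)[OF cP l2 cp] m2 by simp
  qed (use id idJ in auto)
  then show ?thesis
    using ccomp_assoc'[OF cP l2 cp] m2 cat by (simp add: P_def Q_def)
qed

text \<open>Both cancellation laws hold in every extended context, so both paths are weakly
  cocartesian there. The two paths share the outer morphisms \<open>Idt \<K> A\<close> and
  \<open>Idt \<K> B\<close>, and therefore admit the same extensions.\<close>

lemma cocartesian_if_retraction:
  assumes "\<phi> \<star> [\<eta>, \<psi>, \<theta>] = idH \<K> J"
  shows "cocartesian \<K> [\<phi>]" and "cocartesian \<K> [\<eta>, \<psi>, \<theta>]"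
proof -
  have w: "weakly_cocartesian \<K> (ls @ [\<phi>] @ rs) \<and> weakly_cocartesian \<K> (ls @ [\<eta>, \<psi>, \<theta>] @ rs)"
    if ext: "left_extension \<K> (Idt \<K> A) ls" "right_extension \<K> (Idt \<K> B) rs" for ls rs
  proof -
    obtain X ls' where X: "X \<in> Obj \<K>" "cpath \<K> (Idt \<K> X) ls (Idt \<K> A)" and l: "list_all2 inverse_cells ls ls'"
      using left_extension_inverse[OF ext(1)] by auto
    obtain Y rs' where Y: "Y \<in> Obj \<K>" "cpath \<K> (Idt \<K> B) rs (Idt \<K> Y)" and r: "list_all2 inverse_cells rs rs'"
      using right_extension_inverse[OF ext(2)] by auto
    note l' = list_all2_inverse_cells_sym[OF l] and r' = list_all2_inverse_cells_sym[OF r]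
    have X': "cpath \<K> (Idt \<K> X) ls' (Idt \<K> A)" and Y': "cpath \<K> (Idt \<K> B) rs' (Idt \<K> Y)"
      using inverse_paths(1)[OF l] inverse_paths(1)[OF r] X Y by auto
    show ?thesis
    proof
      show "weakly_cocartesian \<K> (ls @ [\<phi>] @ rs)"
        by (rule weakly_cocartesian_if_inverse[of X Y _ "ls' @ [\<eta>, \<psi>, \<theta>] @ rs'"])
          (use X Y X' Y' inverse_paths(2,3)[OF l] inverse_paths(2,3)[OF r]
            ccomp_section_retraction[OF l r X(2) Y(2)]
            ccomp_retraction_section[OF l r X(2) Y(2) _ assms] in \<open>auto simp: cpath_append\<close>)
      \<comment> \<open>The same argument with roles exchanged: now the inverse extensions
        \<open>ls'\<close> and \<open>rs'\<close> accompany \<phi>.\<close>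
      show "weakly_cocartesian \<K> (ls @ [\<eta>, \<psi>, \<theta>] @ rs)"
        by (rule weakly_cocartesian_if_inverse[of X Y _ "ls' @ [\<phi>] @ rs'"])
          (use X Y X' Y' inverse_paths(2,3)[OF l] inverse_paths(2,3)[OF r]
            ccomp_section_retraction[OF l' r' X' Y']
            ccomp_retraction_section[OF l' r' X' Y' _ assms] in \<open>auto simp: cpath_append\<close>)
    qed
  qed
  show "cocartesian \<K> [\<phi>]"
    using w by (auto simp: cocartesian_def cell_path_def)
  show "cocartesian \<K> [\<eta>, \<psi>, \<theta>]"
    using w by (auto simp: cocartesian_def cell_path_def)
qed

lemma retraction_cell: "cell_in \<K> (\<phi> \<star> [\<eta>, \<psi>, \<theta>]) [J] [J] (Idt \<K> A) (Idt \<K> B)"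
  using ccomp_cell_in[OF composable_basic(2), of "Idt \<K> A" "Idt \<K> B"] by (simp add: cell_in_def)

text \<open>With empty extensions, \<open>ccomp_section_retraction\<close> applied to \<phi> itself
  shows that the composite of \<phi> with (\<eta>, \<psi>, \<theta>) factors \<phi> through \<phi>.
  So does \<open>idH \<K> J\<close>, and such factorisations are unique.\<close>

lemma retraction_if_cocartesian:
  assumes "cocartesian \<K> [\<phi>]"
  shows "\<phi> \<star> [\<eta>, \<psi>, \<theta>] = idH \<K> J"
proof -
  have "\<exists>!\<chi>'. cell_in \<K> \<chi>' [J] [J] (Idt \<K> A) (Idt \<K> B) \<and> \<phi> = \<chi>' \<star> [\<phi>]"
    by (rule cocartesian_factor[OF assms \<phi>, where X = A and Y = B]) (use \<phi> Idt_vmor in simp_all)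
  moreover have "(\<phi> \<star> [\<eta>, \<psi>, \<theta>]) \<star> [\<phi>] = \<phi>"
    using ccomp_section_retraction[of "[]" "[]" "[]" "[]" "Idt \<K> A" "Idt \<K> B" \<phi>] composable_basic(2) by simp
  moreover have "idH \<K> J \<star> [\<phi>] = \<phi>" using idH_ccomp[OF \<phi>] .
  moreover have "cell_in \<K> (idH \<K> J) [J] [J] (Idt \<K> A) (Idt \<K> B)" by (simp add: cell_in_def)
  ultimately show ?thesis using retraction_cell by metis
qed

text \<open>Composing with \<psi> turns \<phi> into \<open>E\<close>, and \<open>E_ccomp\<close>
  reduces the result to \<psi>. Thus the composite and \<open>idH \<K> J\<close> are both
  factorisations of \<psi> through itself.\<close>

lemma retraction_if_cartesian:
  assumes "cartesian \<K> \<psi>"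
  shows "\<phi> \<star> [\<eta>, \<psi>, \<theta>] = idH \<K> J"
proof -
  have "cell_path \<K> [\<eta>, \<psi>, \<theta>]" using composable_basic by (simp add: composable_def)
  then have "\<psi> \<star> [\<phi> \<star> [\<eta>, \<psi>, \<theta>]] = E \<star> [\<eta>, \<psi>, \<theta>]"
    using ccomp_assoc'[OF composable_basic(1), of "[[\<eta>, \<psi>, \<theta>]]"] composable_basic by (simp add: E_eq)
  also have "\<dots> = \<psi>" by (rule E_ccomp[OF \<eta> \<psi> \<theta>]) (simp_all add: \<epsilon>\<eta> \<delta>\<theta>)
  finally have "\<psi> \<star> [\<phi> \<star> [\<eta>, \<psi>, \<theta>]] = \<psi>" .
  moreover have "\<psi> \<star> [idH \<K> J] = \<psi>" using ccomp_idH[OF \<psi>] by simp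
  moreover have "\<exists>!\<chi>. cell_in \<K> \<chi> [J] [J] (Idt \<K> A) (Idt \<K> B) \<and> \<psi> = \<psi> \<star> [\<chi>]"
    by (rule cartesian_factor[OF assms \<psi>]) (use \<psi> in auto)
  moreover have "cell_in \<K> (idH \<K> J) [J] [J] (Idt \<K> A) (Idt \<K> B)" by (simp add: cell_in_def)
  ultimately show ?thesis using retraction_cell by metis
qed

text \<open>Existence of factorisations comes from \<open>E_ccomp\<close>. For uniqueness, inserting
  \<open>\<chi> = \<psi> \<star> [\<phi>']\<close> into the constructed factorisation and regrouping
  exposes the retraction, so that \<phi>' is recovered.\<close>

lemma cartesian_if_retraction:
  assumes retr: "\<phi> \<star> [\<eta>, \<psi>, \<theta>] = idH \<K> J"
  shows "cartesian \<K> \<psi>"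
  unfolding cartesian_def
proof (intro conjI allI impI)
  fix \<chi> Hs X Y h k
  assume "vmor \<K> h X (Dom \<K> (VSrc \<K> \<psi>)) \<and> vmor \<K> k Y (Dom \<K> (VTgt \<K> \<psi>)) \<and>
    cell_in \<K> \<chi> Hs (HTgt \<K> \<psi>) (VSrc \<K> \<psi> \<cdot> h) (VTgt \<K> \<psi> \<cdot> k)"
  then have h: "h \<in> Ver \<K>" "Dom \<K> h = X" "Cod \<K> h = A" and k: "k \<in> Ver \<K>" "Dom \<K> k = Y" "Cod \<K> k = B"
    and \<chi>: "cell_in \<K> \<chi> Hs Ks (f \<cdot> h) (g \<cdot> k)"
    by (auto simp: vmor_def)
  have ch1: "composable \<K> \<eta> [idV \<K> h]"
    by (rule composableI[where f = h and g = h]) (use h in simp_all)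
  have ch2: "composable \<K> \<theta> [idV \<K> k]"
    by (rule composableI[where f = k and g = k]) (use k in simp_all)
  note ch = ch1 ch2
  \<comment> \<open>The cells \<eta> and \<theta> are moved along h and k, so that their inner
    vertical ends match those of \<chi>.\<close>
  define a where "a = \<eta> \<star> [idV \<K> h]"
  define b where "b = \<theta> \<star> [idV \<K> k]"
  have a: "cell_in \<K> a [] Fs h (f \<cdot> h)"
    using ccomp_cell_in[OF ch(1), of h h] h by (simp add: a_def cell_in_def)
  have b: "cell_in \<K> b [] Gs (g \<cdot> k) k"
    using ccomp_cell_in[OF ch(2), of k k] k by (simp add: b_def cell_in_def)
  have "composable \<K> \<epsilon> [\<eta>]" by (rule composableI) auto
  then have "\<epsilon> \<star> [a] = idV \<K> f \<star> [idV \<K> h]"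
    using ccomp_assoc'[of \<epsilon> "[\<eta>]" "[[idV \<K> h]]"] ch h by (simp add: a_def \<epsilon>\<eta> cell_path_def)
  then have \<epsilon>a: "\<epsilon> \<star> [a] = idV \<K> (f \<cdot> h)"
    using idV_vcomp[OF _ f] h by (simp add: vmor_def)
  have "composable \<K> \<delta> [\<theta>]" by (rule composableI) auto
  then have "\<delta> \<star> [b] = idV \<K> g \<star> [idV \<K> k]"
    using ccomp_assoc'[of \<delta> "[\<theta>]" "[[idV \<K> k]]"] ch k by (simp add: b_def \<delta>\<theta> cell_path_def)
  then have \<delta>b: "\<delta> \<star> [b] = idV \<K> (g \<cdot> k)"
    using idV_vcomp[OF _ g] k by (simp add: vmor_def)
  have c: "composable \<K> \<phi> [a, \<chi>, b]"
    by (rule composableI[where f = h and g = k]) (use a b \<chi> h k in \<open>auto simp: cell_in_def\<close>)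
  then have cp: "cell_path \<K> [a, \<chi>, b]" by (simp add: composable_def)
  show "\<exists>!\<phi>'. cell_in \<K> \<phi>' Hs (HSrc \<K> \<psi>) h k \<and> \<chi> = \<psi> \<star> [\<phi>']"
  proof (intro ex1I conjI)
    show "cell_in \<K> (\<phi> \<star> [a, \<chi>, b]) Hs (HSrc \<K> \<psi>) h k"
      using ccomp_cell_in[OF c, of h k] a b \<chi> h k by (auto simp: cell_in_def)
    have "\<psi> \<star> [\<phi> \<star> [a, \<chi>, b]] = E \<star> [a, \<chi>, b]"
      using ccomp_assoc'[OF composable_basic(1), of "[[a, \<chi>, b]]"] c cp by (simp add: E_eq)
    also have "\<dots> = \<chi>" by (rule E_ccomp[OF a \<chi> b]) (use h k \<epsilon>a \<delta>b in auto)
    finally show "\<chi> = \<psi> \<star> [\<phi> \<star> [a, \<chi>, b]]" ..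
  next
    fix \<phi>' assume *: "cell_in \<K> \<phi>' Hs (HSrc \<K> \<psi>) h k \<and> \<chi> = \<psi> \<star> [\<phi>']"
    then have \<phi>': "cell_in \<K> \<phi>' Hs [J] h k" and \<chi>_eq: "\<chi> = \<psi> \<star> [\<phi>']" by auto
    have c1: "composable \<K> \<psi> [\<phi>']"
      by (rule composableI[where f = h and g = k]) (use \<phi>' h k in \<open>simp_all add: cell_in_def\<close>)
    have c2: "composable \<K> (idH \<K> J) [\<phi>']"
      by (rule composableI[where f = h and g = k]) (use \<phi>' h k in \<open>simp_all add: cell_in_def\<close>)
    have cp': "cell_path \<K> [idV \<K> h, \<phi>', idV \<K> k]"
      using \<phi>' h k by (auto simp: cell_in_def cell_path_def)
    \<comment> \<open>The path [a, \<chi>, b] is (\<eta>, \<psi>, \<theta>) composed blockwise with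
      the three cells \<open>idV \<K> h\<close>, \<phi>' and \<open>idV \<K> k\<close>.\<close>
    have "\<phi> \<star> [a, \<chi>, b] = (\<phi> \<star> [\<eta>, \<psi>, \<theta>]) \<star> [idV \<K> h, \<phi>', idV \<K> k]"
      using ccomp_assoc'[OF composable_basic(2), of "[[idV \<K> h], [\<phi>'], [idV \<K> k]]"] ch c1 cp'
      by (simp add: a_def b_def \<chi>_eq)
    also have "\<dots> = idH \<K> J \<star> [idV \<K> h, \<phi>', idV \<K> k]" by (simp only: retr)
    also have "\<dots> = idH \<K> J \<star> [idV \<K> h, \<phi>']"
      using ccomp_insert_idV'[of "idH \<K> J" "[idV \<K> h, \<phi>']" "[]" k]
        composable_insert_idV[of "idH \<K> J" "[]" "[\<phi>']" h] c2 \<phi>' h k by (simp add: cell_in_def)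
    also have "\<dots> = idH \<K> J \<star> [\<phi>']"
      using ccomp_insert_idV'[of "idH \<K> J" "[]" "[\<phi>']" h] c2 \<phi>' h by (simp add: cell_in_def)
    also have "\<dots> = \<phi>'" using idH_ccomp[OF \<phi>'] .
    finally show "\<phi>' = \<phi> \<star> [a, \<chi>, b]" ..
  qed
qed auto

lemma equivalences:
  "cartesian \<K> \<psi> \<longleftrightarrow> cocartesian \<K> [\<phi>]"
  "cocartesian \<K> [\<phi>] \<longleftrightarrow> \<phi> \<star> [\<eta>, \<psi>, \<theta>] = idH \<K> J"
  "cartesian \<K> \<psi> \<Longrightarrow> cocartesian \<K> [\<eta>, \<psi>, \<theta>]"
  using cartesian_if_retraction retraction_if_cartesian retraction_if_cocartesian
    cocartesian_if_retraction by blast+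

end

section \<open>Existence of restrictions and of horizontal composites\<close>

context restriction_setting
begin

lemma hmor_if_cell: "cell_in \<K> \<psi> [J] Ks f g \<Longrightarrow> hmor \<K> J A B"
  using HSrc_path[of \<psi>] by (auto simp: cell_in_def hmor_def)

lemma composite_exists:
  assumes "cartesian \<K> \<psi>" "cell_in \<K> \<psi> [J] Ks f g"
  obtains \<phi> where "restriction_composite \<K> A B C D f g Fs Gs Ks \<epsilon> \<eta> \<delta> \<theta> J \<phi> \<psi>"
proof -
  \<comment> \<open>Factor \<open>E\<close> through \<psi> along the identities of A and B.\<close>
  obtain \<phi> where \<phi>: "cell_in \<K> \<phi> (Fs @ Ks @ Gs) [J] (Idt \<K> A) (Idt \<K> B)" "E = \<psi> \<star> [\<phi>]"
    using cartesian_factor[OF assms, of "Idt \<K> A" "Idt \<K> B" E "Fs @ Ks @ Gs"] E_cell by auto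
  have "restriction_composite \<K> A B C D f g Fs Gs Ks \<epsilon> \<eta> \<delta> \<theta> J \<phi> \<psi>"
    by unfold_locales (use \<phi> assms(2) hmor_if_cell in auto)
  then show ?thesis by (rule that)
qed

lemma restriction_exists:
  assumes "cocartesian \<K> [\<phi>]" "cell_in \<K> \<phi> (Fs @ Ks @ Gs) [J] (Idt \<K> A') (Idt \<K> B')"
    "hmor \<K> J A' B'" "Fs @ Ks @ Gs \<noteq> []"
  obtains \<psi> where "restriction_composite \<K> A B C D f g Fs Gs Ks \<epsilon> \<eta> \<delta> \<theta> J \<phi> \<psi>"
proof -
  have O: "A' \<in> Obj \<K>" "B' \<in> Obj \<K>" using assms(3) Src_in Tgt_in by (auto simp: hmor_def)
  have "hpath \<K> A' (Fs @ Ks @ Gs) B'"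
    using HSrc_path[of \<phi>] assms(2) O by (auto simp: cell_in_def)
  \<comment> \<open>The end objects of a composite are existentially quantified in its definition;
    as the path is nonempty, they are forced to be A and B.\<close>
  from hpath_unique[OF this _ assms(4)] have AB: "A' = A" "B' = B"
    using HSrc_path[of E] E_cell by (auto simp: cell_in_def)
  have "\<exists>!\<psi>. cell_in \<K> \<psi> [J] Ks f g \<and> E = \<psi> \<star> [\<phi>]"
    by (rule cocartesian_factor[OF assms(1,2), where X = C and Y = D]) (use f g E_cell AB in simp_all)
  then obtain \<psi> where \<psi>: "cell_in \<K> \<psi> [J] Ks f g" "E = \<psi> \<star> [\<phi>]" by blast
  have "restriction_composite \<K> A B C D f g Fs Gs Ks \<epsilon> \<eta> \<delta> \<theta> J \<phi> \<psi>"
    by unfold_locales (use \<psi> assms(2,3) AB in simp_all)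
  then show ?thesis by (rule that)
qed

lemma restriction_iff_composite:
  assumes "Fs @ Ks @ Gs \<noteq> []"
  shows "(\<exists>J. restriction \<K> J Ks f g) \<longleftrightarrow> (\<exists>J. horizontal_composite \<K> J (Fs @ Ks @ Gs))"
    and "restriction \<K> J Ks f g \<Longrightarrow> horizontal_composite \<K> J' (Fs @ Ks @ Gs) \<Longrightarrow> hiso \<K> J J'"
proof -
  have 1: "horizontal_composite \<K> J (Fs @ Ks @ Gs)" if restr: "restriction \<K> J Ks f g" for J
  proof -
    obtain \<psi> where *: "cell_in \<K> \<psi> [J] Ks f g" "cartesian \<K> \<psi>"
      using restr by (auto simp: restriction_def)
    obtain \<phi> where "restriction_composite \<K> A B C D f g Fs Gs Ks \<epsilon> \<eta> \<delta> \<theta> J \<phi> \<psi>"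
      by (rule composite_exists[OF *(2,1)])
    then interpret restriction_composite \<K> A B C D f g Fs Gs Ks \<epsilon> \<eta> \<delta> \<theta> J \<phi> \<psi> .
    show ?thesis
      unfolding horizontal_composite_def using assms J \<phi> equivalences(1) *(2) by blast
  qed
  have 2: "restriction \<K> J Ks f g" if comp: "horizontal_composite \<K> J (Fs @ Ks @ Gs)" for J
  proof -
    obtain A' B' \<phi> where *: "hmor \<K> J A' B'" "cocartesian \<K> [\<phi>]"
      "cell_in \<K> \<phi> (Fs @ Ks @ Gs) [J] (Idt \<K> A') (Idt \<K> B')"
      using comp by (auto simp: horizontal_composite_def)
    obtain \<psi> where "restriction_composite \<K> A B C D f g Fs Gs Ks \<epsilon> \<eta> \<delta> \<theta> J \<phi> \<psi>"
      by (rule restriction_exists[OF *(2,3,1) assms])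
    then interpret restriction_composite \<K> A B C D f g Fs Gs Ks \<epsilon> \<eta> \<delta> \<theta> J \<phi> \<psi> .
    show ?thesis
      unfolding restriction_def using \<psi> equivalences(1) *(2) by blast
  qed
  show "(\<exists>J. restriction \<K> J Ks f g) \<longleftrightarrow> (\<exists>J. horizontal_composite \<K> J (Fs @ Ks @ Gs))"
    using 1 2 by blast
  show "hiso \<K> J J'" if rc: "restriction \<K> J Ks f g" "horizontal_composite \<K> J' (Fs @ Ks @ Gs)"
  proof -
    obtain \<psi> where \<psi>: "cell_in \<K> \<psi> [J] Ks f g" "cartesian \<K> \<psi>"
      using rc(1) by (auto simp: restriction_def)
    \<comment> \<open>The composite \<open>J'\<close> is itself a restriction, so it suffices to
      compare two cartesian cells over the same data.\<close>
    obtain \<psi>' where \<psi>': "cell_in \<K> \<psi>' [J'] Ks f g" "cartesian \<K> \<psi>'"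
      using 2[OF rc(2)] by (auto simp: restriction_def)
    show ?thesis
      using cartesian_hiso[OF \<psi>(2,1) \<psi>'(2,1)] hmor_if_cell \<psi>(1) \<psi>'(1) by blast
  qed
qed

lemma equivalences:
  assumes "hmor \<K> J A B" "cell_in \<K> \<phi> (Fs @ Ks @ Gs) [J] (Idt \<K> A) (Idt \<K> B)"
    "cell_in \<K> \<psi> [J] Ks f g" "E = \<psi> \<star> [\<phi>]"
  shows "cartesian \<K> \<psi> \<longleftrightarrow> cocartesian \<K> [\<phi>]"
    and "cocartesian \<K> [\<phi>] \<longleftrightarrow> \<phi> \<star> [\<eta>, \<psi>, \<theta>] = idH \<K> J"
    and "cartesian \<K> \<psi> \<Longrightarrow> cocartesian \<K> [\<eta>, \<psi>, \<theta>]"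
    and "composable \<K> \<phi> [\<eta>, \<psi>, \<theta>]"
proof -
  interpret rc: restriction_composite \<K> A B C D f g Fs Gs Ks \<epsilon> \<eta> \<delta> \<theta> J \<phi> \<psi>
    by unfold_locales (use assms in auto)
  show "cartesian \<K> \<psi> \<longleftrightarrow> cocartesian \<K> [\<phi>]"
    and "cocartesian \<K> [\<phi>] \<longleftrightarrow> \<phi> \<star> [\<eta>, \<psi>, \<theta>] = idH \<K> J"
    and "cartesian \<K> \<psi> \<Longrightarrow> cocartesian \<K> [\<eta>, \<psi>, \<theta>]"
    and "composable \<K> \<phi> [\<eta>, \<psi>, \<theta>]"
    by (fact rc.equivalences rc.composable_basic(2))+
qed

lemma hcomp_left: "\<epsilon> \<odot> i\<^sub>K = i\<^sub>K \<star> [\<epsilon>, i\<^sub>K]"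
  and hcomp_right: "i\<^sub>K \<odot> \<delta> = i\<^sub>K \<star> [i\<^sub>K, \<delta>]"
  by (simp_all add: hcomp_def)

lemma E_eq_hcomp: "\<epsilon> \<odot> i\<^sub>K \<odot> \<delta> = E"
proof -
  have c: "composable \<K> i\<^sub>K [\<epsilon>, i\<^sub>K]"
    by (rule composableI[where f = f and g = "Idt \<K> D"]) auto
  have "cell_in \<K> (i\<^sub>K \<star> [\<epsilon>, i\<^sub>K]) (Fs @ Ks) Ks f (Idt \<K> D)"
    using ccomp_cell_in[OF c, of f "Idt \<K> D"] by (simp add: cell_in_def)
  then have "\<epsilon> \<odot> i\<^sub>K \<odot> \<delta> = i\<^sub>K \<star> [i\<^sub>K \<star> [\<epsilon>, i\<^sub>K], \<delta>]"
    unfolding hcomp_left by (simp add: hcomp_def cell_in_def)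
  also have "\<dots> = E"
    using ccomp_flatten(2)[of i\<^sub>K "[]" "[\<epsilon>, i\<^sub>K]" "[\<delta>]" i\<^sub>K] c composable_E by (simp add: E_def)
  finally show ?thesis .
qed

text \<open>With a vertical identity in place of \<delta>, the third cell of \<open>E\<close> can be
  deleted.\<close>

lemma E_eq_left:
  assumes "\<delta> = idV \<K> (Idt \<K> D)"
  shows "\<epsilon> \<odot> i\<^sub>K = E"
  using composable_delete_idV[of i\<^sub>K "[\<epsilon>, i\<^sub>K]" "Idt \<K> D" "[]"] composable_E
    ccomp_insert_idV[of "Idt \<K> D" i\<^sub>K "[\<epsilon>, i\<^sub>K]" "[]"]
  unfolding hcomp_left E_def unfolding assms by simp

lemma E_eq_right:
  assumes "\<epsilon> = idV \<K> (Idt \<K> C)"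
  shows "i\<^sub>K \<odot> \<delta> = E"
  using composable_delete_idV[of i\<^sub>K "[]" "Idt \<K> C" "[i\<^sub>K, \<delta>]"] composable_E
    ccomp_insert_idV[of "Idt \<K> C" i\<^sub>K "[]" "[i\<^sub>K, \<delta>]"]
  unfolding hcomp_right E_def unfolding assms by simp

end

section \<open>Specialisation to the two-sided and one-sided cases\<close>

context augmented_virtual_double_category
begin

text \<open>These are the companion and conjoint identities for the empty path at X, with one cell
  in both roles. The empty path thus stands in for the omitted side, and no horizontal unit at X has
  to exist.\<close>

lemma idV_Idt_unit:
  assumes "X \<in> Obj \<K>"
  defines "u \<equiv> idV \<K> (Idt \<K> X)"
  shows "u \<star> [u] = u" "id_path \<K> X [] \<star> [u, u] = id_path \<K> X []"
    "cell_in \<K> u [] [] (Idt \<K> X) (Idt \<K> X)"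
proof -
  have u: "identity_cell \<K> u" using assms by (auto simp: identity_cell_def)
  have "composable \<K> u [u]" "composable \<K> u [u, u]"
    using assms by (auto intro!: composableI)
  then show "u \<star> [u] = u" "id_path \<K> X [] \<star> [u, u] = id_path \<K> X []"
    using ccomp_identity_cells[of u "[u]"] ccomp_identity_cells[of u "[u, u]"] u
    by (simp_all add: id_path_def u_def)
  show "cell_in \<K> u [] [] (Idt \<K> X) (Idt \<K> X)"
    using assms by (simp add: cell_in_def)
qed

lemma restriction_setting_two_sided:
  assumes "companion \<K> f A C F \<epsilon> \<eta>" "conjoint \<K> g B D G \<delta> \<theta>" "hpath \<K> C Ks D" "length Ks \<le> 1"
  shows "restriction_setting \<K> A B C D f g [F] [G] Ks \<epsilon> \<eta> \<delta> \<theta>"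
  using assms companion_hcomp[OF assms(1)] conjoint_hcomp[OF assms(2)]
  by unfold_locales (auto simp: companion_def conjoint_def id_path_def)

lemma restriction_setting_left:
  assumes "companion \<K> f A C F \<epsilon> \<eta>" "hpath \<K> C Ks D" "length Ks \<le> 1"
  shows "restriction_setting \<K> A D C D f (Idt \<K> D) [F] [] Ks \<epsilon> \<eta>
    (idV \<K> (Idt \<K> D)) (idV \<K> (Idt \<K> D))"
  using assms companion_hcomp[OF assms(1)] hpath_Obj[OF assms(2)] Idt_vmor idV_Idt_unit[of D]
  by unfold_locales (auto simp: companion_def id_path_def)

lemma restriction_setting_right:
  assumes "conjoint \<K> g B D G \<delta> \<theta>" "hpath \<K> C Ks D" "length Ks \<le> 1"
  shows "restriction_setting \<K> C B C D (Idt \<K> C) g [] [G] Ks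
    (idV \<K> (Idt \<K> C)) (idV \<K> (Idt \<K> C)) \<delta> \<theta>"
  using assms conjoint_hcomp[OF assms(1)] hpath_Obj[OF assms(2)] Idt_vmor idV_Idt_unit[of C]
  by unfold_locales (auto simp: conjoint_def id_path_def)

lemma restriction_iff_composite_two_sided:
  assumes "companion \<K> f A C F \<epsilon> \<eta>" "conjoint \<K> g B D G \<delta> \<theta>" "hpath \<K> C Ks D" "length Ks \<le> 1"
  shows "((\<exists>J. restriction \<K> J Ks f g) \<longleftrightarrow> (\<exists>J. horizontal_composite \<K> J ([F] @ Ks @ [G]))) \<and>
    (\<forall>J J'. restriction \<K> J Ks f g \<and> horizontal_composite \<K> J' ([F] @ Ks @ [G]) \<longrightarrow> hiso \<K> J J') \<and>
    (\<forall>J \<phi> \<psi>. hmor \<K> J A B \<and>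
        cell_in \<K> \<phi> ([F] @ Ks @ [G]) [J] (Idt \<K> A) (Idt \<K> B) \<and>
        cell_in \<K> \<psi> [J] Ks f g \<and>
        \<epsilon> \<odot> id_path \<K> C Ks \<odot> \<delta> = \<psi> \<star> [\<phi>] \<longrightarrow>
      (cartesian \<K> \<psi> \<longleftrightarrow> cocartesian \<K> [\<phi>]) \<and>
      (cocartesian \<K> [\<phi>] \<longleftrightarrow> \<phi> \<star> [\<eta>, \<psi>, \<theta>] = idH \<K> J) \<and>
      (cartesian \<K> \<psi> \<longrightarrow> cocartesian \<K> [\<eta>, \<psi>, \<theta>]))"
proof -
  interpret restriction_setting \<K> A B C D f g "[F]" "[G]" Ks \<epsilon> \<eta> \<delta> \<theta>
    by (rule restriction_setting_two_sided[OF assms])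
  have 1: "(\<exists>J. restriction \<K> J Ks f g) \<longleftrightarrow> (\<exists>J. horizontal_composite \<K> J ([F] @ Ks @ [G]))"
    and 2: "restriction \<K> J Ks f g \<Longrightarrow> horizontal_composite \<K> J' ([F] @ Ks @ [G]) \<Longrightarrow> hiso \<K> J J'" for J J'
    using restriction_iff_composite by auto
  have 3: "(cartesian \<K> \<psi> \<longleftrightarrow> cocartesian \<K> [\<phi>]) \<and>
      (cocartesian \<K> [\<phi>] \<longleftrightarrow> \<phi> \<star> [\<eta>, \<psi>, \<theta>] = idH \<K> J) \<and>
      (cartesian \<K> \<psi> \<longrightarrow> cocartesian \<K> [\<eta>, \<psi>, \<theta>])"
    if *: "hmor \<K> J A B"
      "cell_in \<K> \<phi> ([F] @ Ks @ [G]) [J] (Idt \<K> A) (Idt \<K> B)"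
      "cell_in \<K> \<psi> [J] Ks f g"
      "\<epsilon> \<odot> id_path \<K> C Ks \<odot> \<delta> = \<psi> \<star> [\<phi>]" for J \<phi> \<psi>
    using equivalences[OF *(1-3)] *(4) by (simp add: E_eq_hcomp)
  show ?thesis
    by (intro conjI[OF 1 conjI] allI impI; elim conjE; (rule 2 | rule 3); assumption)
qed

lemma restriction_iff_composite_left:
  assumes "companion \<K> f A C F \<epsilon> \<eta>" "hpath \<K> C Ks D" "length Ks \<le> 1"
  shows "((\<exists>J. restriction \<K> J Ks f (Idt \<K> D)) \<longleftrightarrow> (\<exists>J. horizontal_composite \<K> J ([F] @ Ks))) \<and>
    (\<forall>J J'. restriction \<K> J Ks f (Idt \<K> D) \<and> horizontal_composite \<K> J' ([F] @ Ks) \<longrightarrow> hiso \<K> J J') \<and>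
    (\<forall>J \<phi> \<psi>. hmor \<K> J A D \<and>
        cell_in \<K> \<phi> ([F] @ Ks) [J] (Idt \<K> A) (Idt \<K> D) \<and>
        cell_in \<K> \<psi> [J] Ks f (Idt \<K> D) \<and>
        \<epsilon> \<odot> id_path \<K> C Ks = \<psi> \<star> [\<phi>] \<longrightarrow>
      (cartesian \<K> \<psi> \<longleftrightarrow> cocartesian \<K> [\<phi>]) \<and>
      (cocartesian \<K> [\<phi>] \<longleftrightarrow> \<phi> \<star> [\<eta>, \<psi>] = idH \<K> J) \<and>
      (cartesian \<K> \<psi> \<longrightarrow> cocartesian \<K> [\<eta>, \<psi>]))"
proof -
  define u where "u = idV \<K> (Idt \<K> D)"
  interpret restriction_setting \<K> A D C D f "Idt \<K> D" "[F]" "[]" Ks \<epsilon> \<eta> u u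
    using restriction_setting_left[OF assms] by (simp add: u_def)
  have 1: "(\<exists>J. restriction \<K> J Ks f (Idt \<K> D)) \<longleftrightarrow> (\<exists>J. horizontal_composite \<K> J ([F] @ Ks))"
    and 2: "restriction \<K> J Ks f (Idt \<K> D) \<Longrightarrow> horizontal_composite \<K> J' ([F] @ Ks) \<Longrightarrow> hiso \<K> J J'" for J J'
    using restriction_iff_composite by auto
  have 3: "(cartesian \<K> \<psi> \<longleftrightarrow> cocartesian \<K> [\<phi>]) \<and>
      (cocartesian \<K> [\<phi>] \<longleftrightarrow> \<phi> \<star> [\<eta>, \<psi>] = idH \<K> J) \<and>
      (cartesian \<K> \<psi> \<longrightarrow> cocartesian \<K> [\<eta>, \<psi>])"
    if *: "hmor \<K> J A D"
      "cell_in \<K> \<phi> ([F] @ Ks) [J] (Idt \<K> A) (Idt \<K> D)"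
      "cell_in \<K> \<psi> [J] Ks f (Idt \<K> D)"
      "\<epsilon> \<odot> id_path \<K> C Ks = \<psi> \<star> [\<phi>]" for J \<phi> \<psi>
  proof -
    have \<phi>: "cell_in \<K> \<phi> ([F] @ Ks @ []) [J] (Idt \<K> A) (Idt \<K> D)" using *(2) by simp
    have E: "E = \<psi> \<star> [\<phi>]" using *(4) E_eq_left by (simp add: u_def)
    note eq = equivalences[OF *(1) \<phi> *(3) E]
    \<comment> \<open>The placeholder \<open>u\<close> is now deleted from (\<eta>, \<psi>, u),
      first in the composite with \<phi> and then in the cocartesian path.\<close>
    have "composable \<K> \<phi> ([\<eta>, \<psi>] @ [])"
      using composable_delete_idV[of \<phi> "[\<eta>, \<psi>]" "Idt \<K> D" "[]"] eq(4) by (simp add: u_def)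
    then have "\<phi> \<star> [\<eta>, \<psi>, u] = \<phi> \<star> [\<eta>, \<psi>]"
      using ccomp_insert_idV[of "Idt \<K> D" \<phi> "[\<eta>, \<psi>]" "[]"] eq(4) by (simp add: u_def)
    moreover have "cocartesian \<K> [\<eta>, \<psi>, u] \<Longrightarrow> cocartesian \<K> [\<eta>, \<psi>]"
      using cocartesian_delete_idV[of "[\<eta>, \<psi>]" "Idt \<K> D" "[]"] by (simp add: u_def)
    ultimately show ?thesis
      using eq by simp
  qed
  show ?thesis
    by (intro conjI[OF 1 conjI] allI impI; elim conjE; (rule 2 | rule 3); assumption)
qed

lemma restriction_iff_composite_right:
  assumes "conjoint \<K> g B D G \<delta> \<theta>" "hpath \<K> C Ks D" "length Ks \<le> 1"
  shows "((\<exists>J. restriction \<K> J Ks (Idt \<K> C) g) \<longleftrightarrow> (\<exists>J. horizontal_composite \<K> J (Ks @ [G]))) \<and>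
    (\<forall>J J'. restriction \<K> J Ks (Idt \<K> C) g \<and> horizontal_composite \<K> J' (Ks @ [G]) \<longrightarrow> hiso \<K> J J') \<and>
    (\<forall>J \<phi> \<psi>. hmor \<K> J C B \<and>
        cell_in \<K> \<phi> (Ks @ [G]) [J] (Idt \<K> C) (Idt \<K> B) \<and>
        cell_in \<K> \<psi> [J] Ks (Idt \<K> C) g \<and>
        id_path \<K> C Ks \<odot> \<delta> = \<psi> \<star> [\<phi>] \<longrightarrow>
      (cartesian \<K> \<psi> \<longleftrightarrow> cocartesian \<K> [\<phi>]) \<and>
      (cocartesian \<K> [\<phi>] \<longleftrightarrow> \<phi> \<star> [\<psi>, \<theta>] = idH \<K> J) \<and>
      (cartesian \<K> \<psi> \<longrightarrow> cocartesian \<K> [\<psi>, \<theta>]))"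
proof -
  define u where "u = idV \<K> (Idt \<K> C)"
  interpret restriction_setting \<K> C B C D "Idt \<K> C" g "[]" "[G]" Ks u u \<delta> \<theta>
    using restriction_setting_right[OF assms] by (simp add: u_def)
  have 1: "(\<exists>J. restriction \<K> J Ks (Idt \<K> C) g) \<longleftrightarrow> (\<exists>J. horizontal_composite \<K> J (Ks @ [G]))"
    and 2: "restriction \<K> J Ks (Idt \<K> C) g \<Longrightarrow> horizontal_composite \<K> J' (Ks @ [G]) \<Longrightarrow> hiso \<K> J J'" for J J'
    using restriction_iff_composite by auto
  have 3: "(cartesian \<K> \<psi> \<longleftrightarrow> cocartesian \<K> [\<phi>]) \<and>
      (cocartesian \<K> [\<phi>] \<longleftrightarrow> \<phi> \<star> [\<psi>, \<theta>] = idH \<K> J) \<and>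
      (cartesian \<K> \<psi> \<longrightarrow> cocartesian \<K> [\<psi>, \<theta>])"
    if *: "hmor \<K> J C B"
      "cell_in \<K> \<phi> (Ks @ [G]) [J] (Idt \<K> C) (Idt \<K> B)"
      "cell_in \<K> \<psi> [J] Ks (Idt \<K> C) g"
      "id_path \<K> C Ks \<odot> \<delta> = \<psi> \<star> [\<phi>]" for J \<phi> \<psi>
  proof -
    have \<phi>: "cell_in \<K> \<phi> ([] @ Ks @ [G]) [J] (Idt \<K> C) (Idt \<K> B)" using *(2) by simp
    have E: "E = \<psi> \<star> [\<phi>]" using *(4) E_eq_right by (simp add: u_def)
    note eq = equivalences[OF *(1) \<phi> *(3) E]
    have "composable \<K> \<phi> ([] @ [\<psi>, \<theta>])"
      using composable_delete_idV[of \<phi> "[]" "Idt \<K> C" "[\<psi>, \<theta>]"] eq(4) by (simp add: u_def)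
    then have "\<phi> \<star> [u, \<psi>, \<theta>] = \<phi> \<star> [\<psi>, \<theta>]"
      using ccomp_insert_idV[of "Idt \<K> C" \<phi> "[]" "[\<psi>, \<theta>]"] eq(4) by (simp add: u_def)
    moreover have "cocartesian \<K> [u, \<psi>, \<theta>] \<Longrightarrow> cocartesian \<K> [\<psi>, \<theta>]"
      using cocartesian_delete_idV[of "[]" "Idt \<K> C" "[\<psi>, \<theta>]"] by (simp add: u_def)
    ultimately show ?thesis
      using eq by simp
  qed
  show ?thesis
    by (intro conjI[OF 1 conjI] allI impI; elim conjE; (rule 2 | rule 3); assumption)
qed

end

theorem lemma8p1:
  fixes \<K> :: "('o, 'v, 'h, 'c) avdc"
    and A B C D :: 'o and f g :: 'v and fs gs :: 'h
    and \<epsilon>\<^sub>f \<epsilon>\<^sub>g \<eta>\<^sub>f \<eta>\<^sub>g :: 'c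
  assumes "augmented_virtual_double_category \<K>"
  shows
   "(\<forall>Ks. companion \<K> f A C fs \<epsilon>\<^sub>f \<eta>\<^sub>f \<and> conjoint \<K> g B D gs \<epsilon>\<^sub>g \<eta>\<^sub>g \<and>
        hpath \<K> C Ks D \<and> length Ks \<le> 1 \<longrightarrow>
      ((\<exists>J. restriction \<K> J Ks f g) \<longleftrightarrow>
       (\<exists>J. horizontal_composite \<K> J ([fs] @ Ks @ [gs]))) \<and>
      (\<forall>J J'. restriction \<K> J Ks f g \<and> horizontal_composite \<K> J' ([fs] @ Ks @ [gs]) \<longrightarrow>
        hiso \<K> J J') \<and>
      (\<forall>J \<phi> \<psi>. hmor \<K> J A B \<and>
          cell_in \<K> \<phi> ([fs] @ Ks @ [gs]) [J] (Idt \<K> A) (Idt \<K> B) \<and>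
          cell_in \<K> \<psi> [J] Ks f g \<and>
          \<epsilon>\<^sub>f \<odot>\<^bsub>\<K>\<^esub> id_path \<K> C Ks \<odot>\<^bsub>\<K>\<^esub> \<epsilon>\<^sub>g = \<psi> \<star>\<^bsub>\<K>\<^esub> [\<phi>] \<longrightarrow>
        (cartesian \<K> \<psi> \<longleftrightarrow> cocartesian \<K> [\<phi>]) \<and>
        (cocartesian \<K> [\<phi>] \<longleftrightarrow> \<phi> \<star>\<^bsub>\<K>\<^esub> [\<eta>\<^sub>f, \<psi>, \<eta>\<^sub>g] = idH \<K> J) \<and>
        (cartesian \<K> \<psi> \<longrightarrow> cocartesian \<K> [\<eta>\<^sub>f, \<psi>, \<eta>\<^sub>g]))) \<and>
    (\<forall>Ks. companion \<K> f A C fs \<epsilon>\<^sub>f \<eta>\<^sub>f \<and> hpath \<K> C Ks D \<and> length Ks \<le> 1 \<longrightarrow>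
      ((\<exists>J. restriction \<K> J Ks f (Idt \<K> D)) \<longleftrightarrow>
       (\<exists>J. horizontal_composite \<K> J ([fs] @ Ks))) \<and>
      (\<forall>J J'. restriction \<K> J Ks f (Idt \<K> D) \<and> horizontal_composite \<K> J' ([fs] @ Ks) \<longrightarrow>
        hiso \<K> J J') \<and>
      (\<forall>J \<phi> \<psi>. hmor \<K> J A D \<and>
          cell_in \<K> \<phi> ([fs] @ Ks) [J] (Idt \<K> A) (Idt \<K> D) \<and>
          cell_in \<K> \<psi> [J] Ks f (Idt \<K> D) \<and>
          \<epsilon>\<^sub>f \<odot>\<^bsub>\<K>\<^esub> id_path \<K> C Ks = \<psi> \<star>\<^bsub>\<K>\<^esub> [\<phi>] \<longrightarrow>
        (cartesian \<K> \<psi> \<longleftrightarrow> cocartesian \<K> [\<phi>]) \<and>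
        (cocartesian \<K> [\<phi>] \<longleftrightarrow> \<phi> \<star>\<^bsub>\<K>\<^esub> [\<eta>\<^sub>f, \<psi>] = idH \<K> J) \<and>
        (cartesian \<K> \<psi> \<longrightarrow> cocartesian \<K> [\<eta>\<^sub>f, \<psi>]))) \<and>
    (\<forall>Ks. conjoint \<K> g B D gs \<epsilon>\<^sub>g \<eta>\<^sub>g \<and> hpath \<K> C Ks D \<and> length Ks \<le> 1 \<longrightarrow>
      ((\<exists>J. restriction \<K> J Ks (Idt \<K> C) g) \<longleftrightarrow>
       (\<exists>J. horizontal_composite \<K> J (Ks @ [gs]))) \<and>
      (\<forall>J J'. restriction \<K> J Ks (Idt \<K> C) g \<and> horizontal_composite \<K> J' (Ks @ [gs]) \<longrightarrow>
        hiso \<K> J J') \<and>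
      (\<forall>J \<phi> \<psi>. hmor \<K> J C B \<and>
          cell_in \<K> \<phi> (Ks @ [gs]) [J] (Idt \<K> C) (Idt \<K> B) \<and>
          cell_in \<K> \<psi> [J] Ks (Idt \<K> C) g \<and>
          id_path \<K> C Ks \<odot>\<^bsub>\<K>\<^esub> \<epsilon>\<^sub>g = \<psi> \<star>\<^bsub>\<K>\<^esub> [\<phi>] \<longrightarrow>
        (cartesian \<K> \<psi> \<longleftrightarrow> cocartesian \<K> [\<phi>]) \<and>
        (cocartesian \<K> [\<phi>] \<longleftrightarrow> \<phi> \<star>\<^bsub>\<K>\<^esub> [\<psi>, \<eta>\<^sub>g] = idH \<K> J) \<and>
        (cartesian \<K> \<psi> \<longrightarrow> cocartesian \<K> [\<psi>, \<eta>\<^sub>g]))) \<and>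
    (\<forall>K. vmor \<K> f A C \<and> restriction \<K> fs [] f (Idt \<K> C) \<and> hmor \<K> K C D \<longrightarrow>
      ((\<exists>J. restriction \<K> J [K] f (Idt \<K> D)) \<longleftrightarrow>
       (\<exists>J. horizontal_composite \<K> J [fs, K]))) \<and>
    (\<forall>K. vmor \<K> g B D \<and> restriction \<K> gs [] (Idt \<K> D) g \<and> hmor \<K> K C D \<longrightarrow>
      ((\<exists>J. restriction \<K> J [K] (Idt \<K> C) g) \<longleftrightarrow>
       (\<exists>J. horizontal_composite \<K> J [K, gs])))"
proof -
  interpret augmented_virtual_double_category \<K> by (rule assms)
  have hp: "hpath \<K> C [K] D" if "hmor \<K> K C D" for K
    using that Tgt_in by (auto simp: hmor_def)
  have left: "(\<exists>J. restriction \<K> J [K] f (Idt \<K> D)) \<longleftrightarrow> (\<exists>J. horizontal_composite \<K> J [fs, K])"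
    if H: "vmor \<K> f A C \<and> restriction \<K> fs [] f (Idt \<K> C) \<and> hmor \<K> K C D" for K
  proof -
    \<comment> \<open>Only the existence of the restriction is assumed here, so its structure cells
      are chosen first.\<close>
    obtain \<epsilon> \<eta> where "companion \<K> f A C fs \<epsilon> \<eta>"
      using companion_exists H by blast
    from restriction_iff_composite_left[OF this hp] H show ?thesis by simp
  qed
  have right: "(\<exists>J. restriction \<K> J [K] (Idt \<K> C) g) \<longleftrightarrow> (\<exists>J. horizontal_composite \<K> J [K, gs])"
    if H: "vmor \<K> g B D \<and> restriction \<K> gs [] (Idt \<K> D) g \<and> hmor \<K> K C D" for K
  proof -
    obtain \<epsilon> \<eta> where "conjoint \<K> g B D gs \<epsilon> \<eta>"
      using conjoint_exists H by blast
    from restriction_iff_composite_right[OF this hp] H show ?thesis by simp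
  qed
  show ?thesis
    by (intro conjI; intro allI impI;
        ((elim conjE, (rule restriction_iff_composite_two_sided | rule restriction_iff_composite_left | rule restriction_iff_composite_right); assumption)
          | rule left, assumption | rule right, assumption))
qed

end
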